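(* Let $r\ge 3$ and $s\ge 12\lceil \log_2 r\rceil$ be integers. Then every $G_{r,s,t}$ with $1\le t\le r-2$ and every $J_{r,s,d}$ with $2\le d\le s-1$ is $K_r$-Turán-good but is not $K_{r+1}$-Turán-good.
   Context: All graphs are finite and simple. For $r\ge 3$, $s\ge 1$ and $1\le t\le r-2$, $G_{r,s,t}$ is the complete $(r-1)$-partite graph with $t$ parts of size $s+1$ and $r-1-t$ parts of size $s$. For $r\ge3$, $s\ge 3$ and $2\le d\le s-1$, $J_{r,s,d}$ is the graph obtained from the complete $(r-1)$-partite graph with parts $A_1,\dots,A_{r-1}$, each of size $s$, by choosing $u\in A_1$ and distinct vertices $v_1,\dots,v_d\in A_2$ and deleting the edges $uv_1,\dots,uv_d$. $\mathcal N(H,G)$ is the number of (not necessarily induced) subgraphs of $G$ isomorphic to $H$. $T_q(n)$ is the Turán graph: the complete $q$-partite graph on $n$ vertices whose part sizes are $\lfloor n/q\rfloor$ or $\lceil n/q\rceil$. For $q\ge 1$, a graph $H$ is $K_{q+1}$-Turán-good if, for all sufficiently large $n$, $\mathcal N(H,G)\le \mathcal N(H,T_q(n))$ for every $n$-vertex graph $G$ not containing the complete graph $K_{q+1}$ as a subgraph. *)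

theory Defs
  imports Complex_Main
begin

datatype 'a ugraph = UGraph (verts: "'a set") (edges: "'a set set")

definition simple_graph :: "'a ugraph \<Rightarrow> bool" where
  "simple_graph G \<longleftrightarrow>
     finite (verts G) \<and> (\<forall>e\<in>edges G. e \<subseteq> verts G \<and> card e = 2)"

definition subgraph :: "'a ugraph \<Rightarrow> 'a ugraph \<Rightarrow> bool" where
  "subgraph S G \<longleftrightarrow>
     simple_graph S \<and> verts S \<subseteq> verts G \<and> edges S \<subseteq> edges G"

definition graph_iso :: "'a ugraph \<Rightarrow> 'b ugraph \<Rightarrow> bool" where
  "graph_iso G H \<longleftrightarrow>
     (\<exists>f. bij_betw f (verts G) (verts H) \<and>
          (\<forall>x\<in>verts G. \<forall>y\<in>verts G. {x, y} \<in> edges G \<longleftrightarrow> {f x, f y} \<in> edges H))"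

definition num_copies :: "'a ugraph \<Rightarrow> 'b ugraph \<Rightarrow> nat" where
  "num_copies H G = card {S. subgraph S G \<and> graph_iso S H}"

definition contains_copy :: "'b ugraph \<Rightarrow> 'a ugraph \<Rightarrow> bool" where
  "contains_copy G H \<longleftrightarrow> (\<exists>S. subgraph S G \<and> graph_iso S H)"

definition complete_graph :: "nat \<Rightarrow> nat ugraph" where
  "complete_graph k = UGraph {..<k} {{x, y} | x y. x < k \<and> y < k \<and> x \<noteq> y}"

(* The i-th part is {i} x {0..<ks ! i}; parts of size 0 are allowed. *)
definition complete_multipartite :: "nat list \<Rightarrow> (nat \<times> nat) ugraph" where
  "complete_multipartite ks =
     (let V = {(i, j). i < length ks \<and> j < ks ! i}
      in UGraph V {{x, y} | x y. x \<in> V \<and> y \<in> V \<and> fst x \<noteq> fst y})"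

(* For q > 0 the numbers (n + i) div q, i < q, are the part sizes of the Turan
   graph: see the two lemmas below. *)
definition turan_graph :: "nat \<Rightarrow> nat \<Rightarrow> (nat \<times> nat) ugraph" where
  "turan_graph q n = complete_multipartite (map (\<lambda>i. (n + i) div q) [0..<q])"

lemma sum_turan_part_sizes:
  fixes n q :: nat
  assumes "q > 0"
  shows "(\<Sum>i<q. (n + i) div q) = n"
proof (induction n)
  case 0
  show ?case by simp
next
  case (Suc n)
  have "(\<Sum>i<Suc q. (n + i) div q) = n div q + (\<Sum>i<q. (n + Suc i) div q)"
    by (simp only: sum.lessThan_Suc_shift add_0_right)
  moreover have "(\<Sum>i<Suc q. (n + i) div q) = n + (n + q) div q"
    using Suc.IH by simp
  moreover have "(n + q) div q = Suc (n div q)"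
    using assms by simp
  ultimately have "(\<Sum>i<q. (n + Suc i) div q) = Suc n" by linarith
  thus ?case by simp
qed

lemma turan_part_size_floor_or_ceiling:
  fixes n q i :: nat
  assumes "i < q"
  shows "int ((n + i) div q) \<in> {\<lfloor>real n / real q\<rfloor>, \<lceil>real n / real q\<rceil>}"
proof -
  let ?m = "(n + i) div q"
  have q: "real q > 0" using assms by simp
  have "q * ?m \<le> n + i" "n + i < q * ?m + q"
    using assms mod_less_divisor[of q "n + i"] mult_div_mod_eq[of q "n + i"] by linarith+
  hence "q * ?m < n + q" "n < q * ?m + q"
    using assms by linarith+
  hence "real (q * ?m) < real (n + q)" "real n < real (q * ?m + q)"
    by (simp_all only: of_nat_less_iff)
  hence "real ?m < real n / real q + 1" "real n / real q < real ?m + 1"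
    using q by (simp_all add: field_simps)
  thus ?thesis
    by simp linarith
qed

(* K_k-Turan-good, meant for k = q + 1 with q >= 1.  Taking the vertices of G to
   be natural numbers is no restriction, as G is finite. *)
definition turan_good :: "nat \<Rightarrow> 'a ugraph \<Rightarrow> bool" where
  "turan_good k H \<longleftrightarrow>
     (\<forall>\<^sub>F n in sequentially. \<forall>G :: nat ugraph.
        simple_graph G \<and> card (verts G) = n \<and> \<not> contains_copy G (complete_graph k) \<longrightarrow>
        num_copies H G \<le> num_copies H (turan_graph (k - 1) n))"

definition G_graph :: "nat \<Rightarrow> nat \<Rightarrow> nat \<Rightarrow> (nat \<times> nat) ugraph" where
  "G_graph r s t =
     complete_multipartite (replicate t (s + 1) @ replicate (r - 1 - t) s)"

(* Up to isomorphism the choice of u and v_1, ..., v_d is immaterial: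
   here u = (0, 0) and v_(j+1) = (1, j). *)
definition J_graph :: "nat \<Rightarrow> nat \<Rightarrow> nat \<Rightarrow> (nat \<times> nat) ugraph" where
  "J_graph r s d =
     (let K = complete_multipartite (replicate (r - 1) s)
      in UGraph (verts K) (edges K - {{(0, 0), (1, j)} | j. j < d}))"

end

theory Submission
  imports Defs "HOL-Library.FuncSet" "HOL-Combinatorics.Permutations"
begin

text \<open>Put \<open>q = r - 1\<close>. Both families have the vertex set partitioned into \<open>s\<close> cliques of size \<open>q\<close> and one clique
  of size \<open>t\<close> (with \<open>t = 0\<close> for \<open>J\<close>), which is the situation of a theorem of Gyori, Pach and
  Simonovits. In a \<open>K\<^bsub>q+1\<^esub>\<close>-free host the number of tuples of disjoint cliques of these sizes is largest
  for the Turan graph (remove one clique and induct), and a given tuple carries at most as many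
  embeddings as in the Turan graph, where they differ by permutations of the colours. So the
  graphs are \<open>K\<^sub>r\<close>-Turan-good.

  For the negative half compare the Turan graphs with \<open>q\<close> and with \<open>r\<close> parts on \<open>n\<close> vertices. Up to lower
  order terms they contain \<open>q! (n/q)\<^sup>h\<close> and \<open>c (n/r)\<^sup>h\<close> embeddings, where \<open>h\<close> is the order of the
  graph and \<open>c \<le> r! 2\<^sup>s (r + t)\<close> the number of its proper \<open>r\<close>-colourings. The first number is larger
  since \<open>(1 + 1/q)\<^sup>q \<ge> 9/4\<close> and \<open>(9/8)\<^sup>1\<^sup>2 > 4\<close>.\<close>

subsection \<open>Counting cliques\<close>

text \<open>Removing a clique needs a q-clique in the host, and a host may have none. In that case
  any further edge keeps it \<open>K_{q+1}\<close>-free, so edges are added until a q-clique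
  appears; clique counts only grow. Why a tuple carries few embeddings: no host vertex is adjacent
  to all of a q-clique. If the pattern forces a vertex to be adjacent to all vertices of one fixed
  tile but the one of its own colour, that one is its only non-neighbour there, and the colour can
  be read off in the host. In J this may fail only at \<open>u\<close>, which is recovered through
  its own tile. The bound d \<le> s - 1 leaves \<open>u\<close> a neighbour in the second part, so
  that \<open>u\<close> lies in a q-clique at all. The constants: each of the s full tiles gains (1
  + 1/q)^q on passing from r to q parts, while the additional colour costs a factor 2 for each of
  the s vertices of a part. Bernoulli's lower bound 2 would only break even, hence the sharper 9/4.
  The surplus (9/8)^s has to beat r^2, and 12 is the least exponent with (9/8)^12 > 4.\<close>

definition cliques :: "('a \<Rightarrow> 'a \<Rightarrow> bool) \<Rightarrow> nat \<Rightarrow> 'a set \<Rightarrow> 'a set set" where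
  "cliques E m V = {S. S \<subseteq> V \<and> card S = m \<and> (\<forall>x\<in>S. \<forall>y\<in>S. x \<noteq> y \<longrightarrow> E x y)}"

lemma finite_cliques: "finite V \<Longrightarrow> finite (cliques E m V)"
  by (rule finite_subset[of _ "Pow V"]) (auto simp: cliques_def)

lemma cliques_empty_mono:
  assumes "finite V" "cliques E m V = {}" "m \<le> k"
  shows "cliques E k V = {}"
proof (rule ccontr)
  assume "cliques E k V \<noteq> {}"
  then obtain S where S: "S \<in> cliques E k V" by blast
  have "m \<le> card S" using S assms(3) by (simp add: cliques_def)
  then obtain T where "T \<subseteq> S" "card T = m" by (rule obtain_subset_with_card_n)
  then have "T \<in> cliques E m V" using S by (auto simp: cliques_def)
  with assms(2) show False by simp
qed

lemma card_clique_le: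
  assumes "finite V" "cliques E (Suc q) V = {}" "S \<subseteq> V"
    and "\<And>x y. x \<in> S \<Longrightarrow> y \<in> S \<Longrightarrow> x \<noteq> y \<Longrightarrow> E x y"
  shows "card S \<le> q"
proof (rule ccontr)
  assume "\<not> card S \<le> q"
  then have "cliques E (card S) V = {}"
    using cliques_empty_mono[OF assms(1,2)] by simp
  moreover have "S \<in> cliques E (card S) V"
    using assms(3,4) by (auto simp: cliques_def)
  ultimately show False by blast
qed

text \<open>A clique \<open>S\<close> is sorted by \<open>D = S - Q\<close>, and
  \<open>R = S \<inter> Q\<close> is counted for given \<open>D\<close>. This is the recursion of
  \<open>clique_bound\<close>, and it serves the upper bound and the exact count alike.\<close>

lemma card_cliques_split:
  assumes "finite V" "Q \<subseteq> V"
  shows "card (cliques E m V) =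
    (\<Sum>j\<le>m. \<Sum>D\<in>cliques E j (V - Q). card {R. R \<subseteq> Q \<and> R \<union> D \<in> cliques E m V})"
proof -
  let ?X = "\<lambda>D. {R. R \<subseteq> Q \<and> R \<union> D \<in> cliques E m V}"
  let ?S = "SIGMA j:{..m}. SIGMA D:cliques E j (V - Q). ?X D"
  have finQ: "finite Q" using assms finite_subset by blast
  then have finX: "finite (?X D)" for D by simp
  have fin: "finite (cliques E j (V - Q))" for j using assms(1) by (simp add: finite_cliques)
  have "bij_betw (\<lambda>(j, D, R). R \<union> D) ?S (cliques E m V)"
  proof (rule bij_betw_byWitness[where f' = "\<lambda>S. (card (S - Q), S - Q, S \<inter> Q)"])
    show "\<forall>a\<in>?S. (\<lambda>S. (card (S - Q), S - Q, S \<inter> Q)) ((\<lambda>(j, D, R). R \<union> D) a) = a"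
    proof (clarify, goal_cases)
      case (1 j D R)
      have "D \<inter> Q = {}" using 1 by (auto simp: cliques_def)
      then have "(R \<union> D) - Q = D" "(R \<union> D) \<inter> Q = R" using 1 by auto
      then show ?case using 1 by (simp add: cliques_def)
    qed
    show "\<forall>a'\<in>cliques E m V. (\<lambda>(j, D, R). R \<union> D) (card (a' - Q), a' - Q, a' \<inter> Q) = a'"
      by auto
    show "(\<lambda>(j, D, R). R \<union> D) ` ?S \<subseteq> cliques E m V" by auto
    show "(\<lambda>S. (card (S - Q), S - Q, S \<inter> Q)) ` cliques E m V \<subseteq> ?S"
    proof (rule image_subsetI)
      fix S assume 1: "S \<in> cliques E m V"
      have "finite S" using 1 assms(1) finite_subset by (auto simp: cliques_def)
      then have "card (S - Q) \<le> m" using 1 by (auto simp: cliques_def intro!: card_mono)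
      moreover have "S - Q \<in> cliques E (card (S - Q)) (V - Q)" using 1 by (auto simp: cliques_def)
      moreover have "S \<inter> Q \<in> ?X (S - Q)" using 1 by (simp add: Int_Diff_Un)
      ultimately show "(card (S - Q), S - Q, S \<inter> Q) \<in> ?S" by auto
    qed
  qed
  then have "card (cliques E m V) = card ?S" by (rule bij_betw_same_card[symmetric])
  also have "\<dots> = (\<Sum>j\<le>m. card (SIGMA D:cliques E j (V - Q). ?X D))"
    using fin finX by (intro card_SigmaI) auto
  also have "\<dots> = (\<Sum>j\<le>m. \<Sum>D\<in>cliques E j (V - Q). card (?X D))"
    using fin finX by (intro sum.cong refl card_SigmaI) auto
  finally show ?thesis .
qed

text \<open>A clique of size \<open>j\<close> outside a \<open>q\<close>-clique \<open>Q\<close> of a \<open>K\<^bsub>q+1\<^esub>\<close>-free graph has at most \<open>q - j\<close> common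
  neighbours in \<open>Q\<close>. The recursion sums over \<open>j\<close> and is exact for Turan graphs.\<close>

function clique_bound :: "nat \<Rightarrow> nat \<Rightarrow> nat \<Rightarrow> nat" where
  "clique_bound q n m =
     (if n < q \<or> q = 0 then n choose m
      else \<Sum>j\<le>m. clique_bound q (n - q) j * ((q - j) choose (m - j)))"
  by auto
termination by (relation "measure (\<lambda>(q, n, m). n)") auto

declare clique_bound.simps [simp del]

section \<open>Upper bound for clique counts\<close>

text \<open>One new edge raises the clique number by at most one, since deleting its end
  \<open>a\<close> from a clique leaves a clique of the old graph. So while there is no q-clique, an
  edge can be added safely; \<open>q \<le> card V\<close> guarantees a missing one among any
  \<open>q\<close> vertices, and the number of non-adjacent pairs decreases.\<close>

lemma exists_saturation:
  assumes "finite V" "symp E" "cliques E (Suc q) V = {}" "q \<le> card V"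
  shows "\<exists>E'. symp E' \<and> (\<forall>x y. E x y \<longrightarrow> E' x y) \<and> cliques E' (Suc q) V = {} \<and> cliques E' q V \<noteq> {}"
  using assms(2,3)
proof (induction "card {(x, y). x \<in> V \<and> y \<in> V \<and> \<not> E x y}" arbitrary: E rule: less_induct)
  case less
  show ?case
  proof (cases "cliques E q V = {}")
    case False
    then show ?thesis using less.prems by blast
  next
    case True
    obtain T where T: "T \<subseteq> V" "card T = q"
      using obtain_subset_with_card_n[OF assms(4)] by blast
    have "T \<notin> cliques E q V" using True by blast
    then obtain a b where ab: "a \<in> V" "b \<in> V" "a \<noteq> b" "\<not> E a b"
      using T by (auto simp: cliques_def)
    define F where "F x y \<longleftrightarrow> E x y \<or> {x, y} = {a, b}" for x y
    have sym: "symp F" using less.prems(1) by (auto simp: F_def symp_def insert_commute)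
    have none: "cliques F (Suc q) V = {}"
    proof (rule ccontr)
      assume "cliques F (Suc q) V \<noteq> {}"
      then obtain S where S: "S \<in> cliques F (Suc q) V" by blast
      have fS: "finite S" using S assms(1) finite_subset by (auto simp: cliques_def)
      have cl: "E x y" if "x \<in> S - {a}" "y \<in> S - {a}" "x \<noteq> y" for x y
        using S that by (auto simp: cliques_def F_def doubleton_eq_iff)
      have c: "card (S - {a}) \<ge> q" using S fS by (auto simp: cliques_def card_Diff_singleton_if)
      have "S - {a} \<in> cliques E (card (S - {a})) V"
        using S cl by (auto simp: cliques_def)
      moreover have "cliques E (card (S - {a})) V = {}"
        using cliques_empty_mono[OF assms(1) True c] .
      ultimately show False by blast
    qed
    have "{(x, y). x \<in> V \<and> y \<in> V \<and> \<not> F x y} \<subset> {(x, y). x \<in> V \<and> y \<in> V \<and> \<not> E x y}"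
      using ab by (auto simp: F_def)
    moreover have "finite {(x, y). x \<in> V \<and> y \<in> V \<and> \<not> E x y}"
      by (rule finite_subset[of _ "V \<times> V"]) (use assms(1) in auto)
    ultimately have "card {(x, y). x \<in> V \<and> y \<in> V \<and> \<not> F x y} < card {(x, y). x \<in> V \<and> y \<in> V \<and> \<not> E x y}"
      by (rule psubset_card_mono[rotated])
    from less.hyps[OF this sym none] show ?thesis by (auto simp: F_def)
  qed
qed

lemma card_cliques_le_choose:
  assumes "finite V"
  shows "card (cliques E m V) \<le> card V choose m"
proof -
  have "card (cliques E m V) \<le> card {S. S \<subseteq> V \<and> card S = m}"
    using assms by (intro card_mono) (auto simp: cliques_def)
  then show ?thesis using assms by (simp add: n_subsets)
qed

lemma card_cliques_le:
  assumes "finite V" "symp E" "cliques E (Suc q) V = {}" "q \<ge> 1"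
  shows "card (cliques E m V) \<le> clique_bound q (card V) m"
  using assms(1-3)
proof (induction "card V" arbitrary: V E m rule: less_induct)
  case less
  show ?case
  proof (cases "card V < q")
    case True
    then show ?thesis using card_cliques_le_choose[OF less.prems(1), of E m]
      by (subst clique_bound.simps) simp
  next
    case False
    then obtain F where F: "symp F" "\<And>x y. E x y \<Longrightarrow> F x y" "cliques F (Suc q) V = {}"
      "cliques F q V \<noteq> {}"
      using exists_saturation[OF less.prems, of] by auto
    then obtain Q where Q: "Q \<in> cliques F q V" by blast
    then have QV: "Q \<subseteq> V" and cQ: "card Q = q" by (auto simp: cliques_def)
    have fQ: "finite Q" using QV less.prems(1) finite_subset by blast
    have cV: "card (V - Q) = card V - q" using QV fQ cQ by (simp add: card_Diff_subset)
    have "cliques F (Suc q) (V - Q) \<subseteq> cliques F (Suc q) V" by (auto simp: cliques_def)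
    then have noneF: "cliques F (Suc q) (V - Q) = {}" using F(3) by blast
    \<comment> \<open>The hypothesis is used for the enlarged relation \<open>F\<close>, so
      \<open>E\<close> has to vary in the induction.\<close>
    have IH: "card (cliques F j (V - Q)) \<le> clique_bound q (card V - q) j" for j
      using less.hyps[of "V - Q" F j] less.prems(1) noneF F(1) cV False assms(4) by simp
    have ext: "card {R. R \<subseteq> Q \<and> R \<union> D \<in> cliques F m V} \<le> (q - j) choose (m - j)"
      if D: "D \<in> cliques F j (V - Q)" for D j
    proof -
      let ?N = "{x \<in> Q. \<forall>d\<in>D. F x d}"
      have fD: "finite D" using D less.prems(1) finite_subset by (auto simp: cliques_def)
      have cD: "card D = j" and DQ: "D \<inter> Q = {}" using D by (auto simp: cliques_def)
      \<comment> \<open>\<open>?N\<close> lies in the clique \<open>Q\<close> and is joined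
        completely to \<open>D\<close>, so the union is a clique again.\<close>
      have "card (?N \<union> D) \<le> q"
        using Q D QV by (intro card_clique_le[OF less.prems(1) F(3)])
          (auto simp: cliques_def dest: sympD[OF F(1)])
      moreover have "card (?N \<union> D) = card ?N + j"
        using fQ fD DQ cD by (subst card_Un_disjoint) auto
      ultimately have N: "card ?N \<le> q - j" by simp
      have "{R. R \<subseteq> Q \<and> R \<union> D \<in> cliques F m V} \<subseteq> {R. R \<subseteq> ?N \<and> card R = m - j}"
      proof (clarify, intro conjI subsetI)
        fix R assume R: "R \<subseteq> Q" "R \<union> D \<in> cliques F m V"
        have RD: "R \<inter> D = {}" using R DQ by blast
        have "F x d" if "x \<in> R" "d \<in> D" for x d
        proof -
          have "x \<noteq> d" using that RD by blast
          then show ?thesis using that R(2) by (simp add: cliques_def)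
        qed
        then show "x \<in> ?N" if "x \<in> R" for x using that R(1) by blast
        have "card (R \<union> D) = card R + j"
          using RD cD fD R fQ finite_subset[of R Q] by (subst card_Un_disjoint) auto
        then show "card R = m - j" using R by (auto simp: cliques_def)
      qed
      then have "card {R. R \<subseteq> Q \<and> R \<union> D \<in> cliques F m V} \<le> card {R. R \<subseteq> ?N \<and> card R = m - j}"
        using fQ by (intro card_mono) auto
      also have "\<dots> = card ?N choose (m - j)" using fQ by (simp add: n_subsets)
      also have "\<dots> \<le> (q - j) choose (m - j)" using N by (rule binomial_right_mono)
      finally show ?thesis .
    qed
    have "card (cliques E m V) \<le> card (cliques F m V)"
      using less.prems(1) F(2) by (intro card_mono finite_cliques) (auto simp: cliques_def)
    also have "\<dots> = (\<Sum>j\<le>m. \<Sum>D\<in>cliques F j (V - Q). card {R. R \<subseteq> Q \<and> R \<union> D \<in> cliques F m V})"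
      by (rule card_cliques_split[OF less.prems(1) QV])
    also have "\<dots> \<le> (\<Sum>j\<le>m. \<Sum>D\<in>cliques F j (V - Q). (q - j) choose (m - j))"
      using ext by (intro sum_mono)
    also have "\<dots> \<le> (\<Sum>j\<le>m. clique_bound q (card V - q) j * ((q - j) choose (m - j)))"
      using IH by (intro sum_mono) simp
    also have "\<dots> = clique_bound q (card V) m"
      using False assms(4) by (subst (2) clique_bound.simps) simp
    finally show ?thesis .
  qed
qed

section \<open>Exact clique counts in Turan graphs\<close>

text \<open>Turan graphs up to isomorphism, with \<open>c\<close> naming the part of a vertex. Empty
  parts are allowed, and the class is closed under deleting one vertex from each part, as the
  induction on the number of vertices requires.\<close>

locale balanced_multipartite =
  fixes V :: "'a set" and E :: "'a \<Rightarrow> 'a \<Rightarrow> bool" and c :: "'a \<Rightarrow> nat" and q :: nat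
  assumes fin: "finite V"
    and col: "x \<in> V \<Longrightarrow> c x < q"
    and adj: "x \<in> V \<Longrightarrow> y \<in> V \<Longrightarrow> E x y \<longleftrightarrow> c x \<noteq> c y"
    and bal: "i < q \<Longrightarrow> j < q \<Longrightarrow> card {v \<in> V. c v = i} \<le> Suc (card {v \<in> V. c v = j})"
begin

lemma card_V: "card V = (\<Sum>i<q. card {v \<in> V. c v = i})"
proof -
  have "card V = card (\<Union>i\<in>{..<q}. {v \<in> V. c v = i})"
    using col by (intro arg_cong[where f = card]) auto
  also have "\<dots> = (\<Sum>i<q. card {v \<in> V. c v = i})"
    using fin by (intro card_UN_disjoint) auto
  finally show ?thesis .
qed

lemma part_nonempty:
  assumes "q \<le> card V" "i < q"
  shows "\<exists>v\<in>V. c v = i"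
proof (rule ccontr)
  assume "\<not> ?thesis"
  then have "{v \<in> V. c v = i} = {}" by blast
  then have 0: "card {v \<in> V. c v = i} = 0" by (simp only: card.empty)
  have "card V = (\<Sum>j<q. card {v \<in> V. c v = j})" by (rule card_V)
  also have "\<dots> < (\<Sum>j<q. 1)"
    using assms(2) bal[of _ i] 0
    by (intro sum_strict_mono_ex1) (auto simp: 0 intro!: bexI[of _ i])
  finally show False using assms by simp
qed

text \<open>Fewer vertices than colours leave some part empty, and balance then caps every part at
  one vertex. The graph is complete, which is the base case of \<open>clique_bound\<close>.\<close>

lemma inj_on_small:
  assumes "card V < q"
  shows "inj_on c V"
proof -
  have "\<exists>i<q. {v \<in> V. c v = i} = {}"
  proof (rule ccontr)
    assume *: "\<not> ?thesis"
    have "(\<Sum>j<q. 1) \<le> (\<Sum>j<q. card {v \<in> V. c v = j})"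
      using fin * by (intro sum_mono) (auto simp: Suc_le_eq card_gt_0_iff)
    then show False using card_V assms by simp
  qed
  then obtain i where i: "i < q" "{v \<in> V. c v = i} = {}" by blast
  show ?thesis
  proof (rule inj_onI, rule ccontr)
    fix x y assume xy: "x \<in> V" "y \<in> V" "c x = c y" "x \<noteq> y"
    have "card {x, y} \<le> card {v \<in> V. c v = c x}"
      using xy fin by (intro card_mono) auto
    also have "\<dots> \<le> 1" using bal[OF col[OF xy(1)] i(1)] i(2) by simp
    finally show False using xy by simp
  qed
qed

lemma inj_on_clique: "S \<in> cliques E m V \<Longrightarrow> inj_on c S"
  using adj by (fastforce simp: cliques_def inj_on_def)

lemma clique_iff: "S \<in> cliques E m V \<longleftrightarrow> S \<subseteq> V \<and> card S = m \<and> inj_on c S"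
  using adj by (auto simp: cliques_def inj_on_def) blast+

lemma colours_full_clique:
  assumes "S \<in> cliques E q V"
  shows "c ` S = {..<q}"
proof -
  have "c ` S \<subseteq> {..<q}" using assms col by (auto simp: cliques_def)
  moreover have "card (c ` S) = q"
    using assms inj_on_clique[OF assms] by (simp add: card_image cliques_def)
  ultimately show ?thesis by (intro card_subset_eq) auto
qed

text \<open>A q-clique meets every part exactly once, so all part sizes drop by one and their
  differences are kept.\<close>

lemma remove_full_clique:
  assumes "Q \<in> cliques E q V"
  shows "balanced_multipartite (V - Q) E c q"
proof
  have "card {v \<in> V - Q. c v = i} = card {v \<in> V. c v = i} - 1" if "i < q" for i
  proof -
    obtain x where x: "x \<in> Q" "c x = i" using colours_full_clique[OF assms] \<open>i < q\<close>
      by (metis imageE lessThan_iff)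
    have "{v \<in> V - Q. c v = i} = {v \<in> V. c v = i} - {x}"
      using x inj_on_clique[OF assms] by (auto simp: inj_on_def)
    moreover have "x \<in> V" using x assms by (auto simp: cliques_def)
    ultimately show ?thesis using x fin by simp
  qed
  then show "card {v \<in> V - Q. c v = i} \<le> Suc (card {v \<in> V - Q. c v = j})" if "i < q" "j < q" for i j
    using that bal[OF that] by simp
qed (use fin col adj in auto)

end

text \<open>The equality case of the extension bound in \<open>card_cliques_le\<close>: the vertices
  of \<open>Q\<close> adjacent to all of \<open>D\<close> are those whose colours \<open>D\<close>
  misses, exactly \<open>q - j\<close> of them.\<close>

lemma (in balanced_multipartite) card_ext:
  assumes Q: "Q \<in> cliques E q V" and D: "D \<in> cliques E j (V - Q)" and "j \<le> m"
  shows "card {R. R \<subseteq> Q \<and> R \<union> D \<in> cliques E m V} = (q - j) choose (m - j)"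
proof -
  let ?N = "{x \<in> Q. c x \<notin> c ` D}"
  interpret VQ: balanced_multipartite "V - Q" E c q by (rule remove_full_clique[OF Q])
  have QV: "Q \<subseteq> V" and cQ: "card Q = q" using Q by (auto simp: cliques_def)
  have fQ: "finite Q" using QV fin finite_subset by blast
  have DV: "D \<subseteq> V - Q" and cD: "card D = j" using D by (auto simp: cliques_def)
  have fD: "finite D" using DV fin finite_subset by blast
  have iD: "inj_on c D" and iQ: "inj_on c Q"
    using VQ.inj_on_clique[OF D] inj_on_clique[OF Q] by auto
  have "c ` ?N = {..<q} - c ` D" using colours_full_clique[OF Q] by auto
  moreover have "c ` D \<subseteq> {..<q}" using DV col by auto
  ultimately have "card (c ` ?N) = q - j"
    using fD iD cD by (simp add: card_Diff_subset card_image)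
  moreover have "inj_on c ?N" using iQ by (rule inj_on_subset) auto
  ultimately have N: "card ?N = q - j" by (simp add: card_image)
  have "{R. R \<subseteq> Q \<and> R \<union> D \<in> cliques E m V} = {R. R \<subseteq> ?N \<and> card R = m - j}"
  proof (intro set_eqI iffI; clarify)
    fix R assume R: "R \<subseteq> Q" "R \<union> D \<in> cliques E m V"
    have RD: "R \<inter> D = {}" using R DV by blast
    have "inj_on c (R \<union> D)" using inj_on_clique R by blast
    then have "c ` R \<inter> c ` D = {}" using RD by (auto simp: inj_on_def)
    moreover have "card (R \<union> D) = card R + j"
      using RD cD fD R fQ finite_subset[of R Q] by (subst card_Un_disjoint) auto
    ultimately show "R \<subseteq> ?N \<and> card R = m - j" using R by (auto simp: cliques_def)
  next
    fix R assume R: "R \<subseteq> ?N" "card R = m - j"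
    have RD: "R \<inter> D = {}" using R DV by blast
    have "inj_on c (R \<union> D)"
      using R iD inj_on_subset[OF iQ, of R] by (auto simp: inj_on_Un)
    moreover have "card (R \<union> D) = card R + j"
      using RD cD fD R fQ finite_subset[of R Q] by (subst card_Un_disjoint) auto
    ultimately show "R \<subseteq> Q \<and> R \<union> D \<in> cliques E m V"
      using R QV DV assms(3) by (auto simp: clique_iff)
  qed
  then show ?thesis using N fQ by (simp add: n_subsets)
qed

lemma balanced_card_cliques:
  assumes "balanced_multipartite V E c q" "q \<ge> 1" "m \<le> q"
  shows "card (cliques E m V) = clique_bound q (card V) m"
  using assms(1,3)
proof (induction "card V" arbitrary: V m rule: less_induct)
  case less
  interpret balanced_multipartite V E c q by fact
  show ?case
  proof (cases "card V < q")
    case True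
    have "cliques E m V = {S. S \<subseteq> V \<and> card S = m}"
      using inj_on_small[OF True] by (auto simp: clique_iff intro: inj_on_subset)
    then show ?thesis using True fin by (subst clique_bound.simps) (simp add: n_subsets)
  next
    case False
    then have "\<forall>i\<in>{..<q}. \<exists>v. v \<in> V \<and> c v = i" using part_nonempty by fastforce
    then obtain g where g: "\<And>i. i < q \<Longrightarrow> g i \<in> V \<and> c (g i) = i"
      unfolding bchoice_iff by auto
    \<comment> \<open>A transversal of the parts is a q-clique to remove; no edges have to be added
      here.\<close>
    let ?Q = "g ` {..<q}"
    have "inj_on g {..<q}" using g by (metis inj_onI lessThan_iff)
    moreover have "inj_on c ?Q" using g by (auto simp: inj_on_def)
    ultimately have Q: "?Q \<in> cliques E q V" using g by (auto simp: clique_iff card_image)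
    then have QV: "?Q \<subseteq> V" and cQ: "card ?Q = q" by (auto simp: cliques_def)
    have cV: "card (V - ?Q) = card V - q" using QV cQ by (simp add: card_Diff_subset)
    have IH: "card (cliques E j (V - ?Q)) = clique_bound q (card V - q) j" if "j \<le> m" for j
      using less.hyps[of "V - ?Q" j] remove_full_clique[OF Q] cV False assms(2) less.prems(2) that
      by simp
    have "card (cliques E m V) = (\<Sum>j\<le>m. \<Sum>D\<in>cliques E j (V - ?Q). card {R. R \<subseteq> ?Q \<and> R \<union> D \<in> cliques E m V})"
      by (rule card_cliques_split[OF fin QV])
    also have "\<dots> = (\<Sum>j\<le>m. \<Sum>D\<in>cliques E j (V - ?Q). (q - j) choose (m - j))"
      using card_ext[OF Q] by (intro sum.cong refl) auto
    also have "\<dots> = (\<Sum>j\<le>m. clique_bound q (card V - q) j * ((q - j) choose (m - j)))"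
      using IH by (intro sum.cong refl) simp
    also have "\<dots> = clique_bound q (card V) m"
      using False assms(2) by (subst (2) clique_bound.simps) simp
    finally show ?thesis .
  qed
qed

section \<open>Tuples of disjoint cliques\<close>

text \<open>The t-clique comes last because deleting q-cliques keeps a Turan graph balanced, whereas
  deleting a smaller clique need not.\<close>

fun clique_tuples :: "('a \<Rightarrow> 'a \<Rightarrow> bool) \<Rightarrow> nat \<Rightarrow> nat \<Rightarrow> nat \<Rightarrow> 'a set \<Rightarrow> 'a set list set" where
  "clique_tuples E q t 0 V = (\<lambda>D. [D]) ` cliques E t V"
| "clique_tuples E q t (Suc k) V = (\<Union>Q\<in>cliques E q V. (#) Q ` clique_tuples E q t k (V - Q))"

text \<open>A product although the choices depend on each other: the bound for each choice involves
  only the number of vertices that are left.\<close>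

fun tuple_bound :: "nat \<Rightarrow> nat \<Rightarrow> nat \<Rightarrow> nat \<Rightarrow> nat" where
  "tuple_bound q t 0 n = clique_bound q n t"
| "tuple_bound q t (Suc k) n = clique_bound q n q * tuple_bound q t k (n - q)"

lemma finite_clique_tuples: "finite V \<Longrightarrow> finite (clique_tuples E q t k V)"
  by (induction k arbitrary: V) (auto simp: finite_cliques)

lemma card_clique_tuples_Suc:
  assumes "finite V"
  shows "card (clique_tuples E q t (Suc k) V) =
    (\<Sum>Q\<in>cliques E q V. card (clique_tuples E q t k (V - Q)))"
proof -
  have "card (clique_tuples E q t (Suc k) V) =
    (\<Sum>Q\<in>cliques E q V. card ((#) Q ` clique_tuples E q t k (V - Q)))"
    unfolding clique_tuples.simps using assms
    by (intro card_UN_disjoint) (auto simp: finite_cliques finite_clique_tuples)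
  then show ?thesis by (simp add: card_image)
qed

lemma card_clique_tuples_le:
  assumes "finite V" "symp E" "cliques E (Suc q) V = {}" "q \<ge> 1"
  shows "card (clique_tuples E q t k V) \<le> tuple_bound q t k (card V)"
  using assms(1,3)
proof (induction k arbitrary: V)
  case 0
  then show ?case using card_cliques_le[OF 0(1) assms(2) 0(2) assms(4)]
    by (simp add: card_image inj_on_def)
next
  case (Suc k)
  have "card (clique_tuples E q t k (V - Q)) \<le> tuple_bound q t k (card V - q)"
    if "Q \<in> cliques E q V" for Q
  proof -
    have "Q \<subseteq> V" "card Q = q" using that by (auto simp: cliques_def)
    then have "card (V - Q) = card V - q"
      using Suc.prems(1) finite_subset by (metis card_Diff_subset)
    moreover have "cliques E (Suc q) (V - Q) = {}"
      using Suc.prems(2) by (auto simp: cliques_def)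
    ultimately show ?thesis using Suc.IH[of "V - Q"] Suc.prems(1) by simp
  qed
  then have "(\<Sum>Q\<in>cliques E q V. card (clique_tuples E q t k (V - Q)))
      \<le> (\<Sum>Q\<in>cliques E q V. tuple_bound q t k (card V - q))"
    by (intro sum_mono)
  also have "\<dots> \<le> tuple_bound q t (Suc k) (card V)"
    using card_cliques_le[OF Suc.prems(1) assms(2) Suc.prems(2) assms(4)] by simp
  finally show ?case by (simp only: card_clique_tuples_Suc[OF Suc.prems(1)])
qed

lemma balanced_card_clique_tuples:
  assumes "balanced_multipartite V E c q" "q \<ge> 1" "t \<le> q"
  shows "card (clique_tuples E q t k V) = tuple_bound q t k (card V)"
  using assms(1)
proof (induction k arbitrary: V)
  case 0
  then show ?case using balanced_card_cliques[OF 0 assms(2,3)]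
    by (simp add: card_image inj_on_def)
next
  case (Suc k)
  interpret balanced_multipartite V E c q by fact
  have "card (clique_tuples E q t k (V - Q)) = tuple_bound q t k (card V - q)"
    if "Q \<in> cliques E q V" for Q
  proof -
    have "Q \<subseteq> V" "card Q = q" using that by (auto simp: cliques_def)
    then have "card (V - Q) = card V - q"
      using fin finite_subset by (metis card_Diff_subset)
    then show ?thesis using Suc.IH[OF remove_full_clique[OF that]] by simp
  qed
  then show ?case
    by (simp add: card_clique_tuples_Suc[OF fin] balanced_card_cliques[OF Suc.prems assms(2)]
        del: clique_tuples.simps)
qed

text \<open>The form without recursion, in which the tiles of an embedding can be checked one by
  one.\<close>

lemma clique_tuples_iff:
  "Qs \<in> clique_tuples E q t k V \<longleftrightarrow>
     length Qs = Suc k \<and> (\<forall>i\<le>k. Qs ! i \<in> cliques E (if i < k then q else t) V) \<and>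
     (\<forall>i\<le>k. \<forall>j\<le>k. i \<noteq> j \<longrightarrow> Qs ! i \<inter> Qs ! j = {})"
proof (induction k arbitrary: V Qs)
  case 0
  show ?case by (cases Qs) auto
next
  case (Suc k)
  show ?case
  proof (cases Qs)
    case Nil
    then show ?thesis by auto
  next
    case (Cons Q Rs)
    have all: "(\<forall>i\<le>Suc k. P i) \<longleftrightarrow> P 0 \<and> (\<forall>i\<le>k. P (Suc i))" for P
      by (metis Suc_le_mono not0_implies_Suc zero_le)
    have *: "Rs ! i \<in> cliques E m (V - Q) \<longleftrightarrow> Rs ! i \<in> cliques E m V \<and> Q \<inter> Rs ! i = {}" for i m
      by (auto simp: cliques_def)
    have "Qs \<in> clique_tuples E q t (Suc k) V \<longleftrightarrow>
        Q \<in> cliques E q V \<and> Rs \<in> clique_tuples E q t k (V - Q)"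
      by (auto simp: Cons)
    also have "\<dots> \<longleftrightarrow> Q \<in> cliques E q V \<and> length Rs = Suc k \<and>
        (\<forall>i\<le>k. Rs ! i \<in> cliques E (if i < k then q else t) V) \<and>
        (\<forall>i\<le>k. Q \<inter> Rs ! i = {}) \<and> (\<forall>i\<le>k. \<forall>j\<le>k. i \<noteq> j \<longrightarrow> Rs ! i \<inter> Rs ! j = {})"
      unfolding Suc.IH[of Rs "V - Q"] * imp_conjR all_conj_distrib by (simp only: conj_assoc)
    finally have "Qs \<in> clique_tuples E q t (Suc k) V \<longleftrightarrow> \<dots>" .
    moreover have "(\<forall>i\<le>Suc k. Qs ! i \<in> cliques E (if i < Suc k then q else t) V) \<longleftrightarrow>
        Q \<in> cliques E q V \<and> (\<forall>i\<le>k. Rs ! i \<in> cliques E (if i < k then q else t) V)"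
      by (subst all) (simp add: Cons)
    moreover have "(\<forall>i\<le>Suc k. \<forall>j\<le>Suc k. i \<noteq> j \<longrightarrow> Qs ! i \<inter> Qs ! j = {}) \<longleftrightarrow>
        (\<forall>i\<le>k. Q \<inter> Rs ! i = {}) \<and> (\<forall>i\<le>k. \<forall>j\<le>k. i \<noteq> j \<longrightarrow> Rs ! i \<inter> Rs ! j = {})"
      unfolding all by (simp add: Cons Int_commute[where B = Q] all_conj_distrib imp_conjR)
    moreover have "length Qs = Suc (Suc k) \<longleftrightarrow> length Rs = Suc k" by (simp add: Cons)
    ultimately show ?thesis by (simp only: conj_ac)
  qed
qed

subsection \<open>Copies and embeddings\<close>

definition embeddings :: "'v set \<Rightarrow> ('v \<Rightarrow> 'v \<Rightarrow> bool) \<Rightarrow> 'a set \<Rightarrow> ('a \<Rightarrow> 'a \<Rightarrow> bool) \<Rightarrow> ('v \<Rightarrow> 'a) set" where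
  "embeddings W A V E =
     {f \<in> W \<rightarrow>\<^sub>E V. inj_on f W \<and> (\<forall>x\<in>W. \<forall>y\<in>W. A x y \<longrightarrow> E (f x) (f y))}"

definition isos :: "'v ugraph \<Rightarrow> 'a ugraph \<Rightarrow> ('v \<Rightarrow> 'a) set" where
  "isos H S = {f \<in> verts H \<rightarrow>\<^sub>E verts S. bij_betw f (verts H) (verts S) \<and>
     (\<forall>x\<in>verts H. \<forall>y\<in>verts H. {x, y} \<in> edges H \<longleftrightarrow> {f x, f y} \<in> edges S)}"

abbreviation adj :: "'v ugraph \<Rightarrow> 'v \<Rightarrow> 'v \<Rightarrow> bool" where
  "adj G x y \<equiv> {x, y} \<in> edges G"

abbreviation embs :: "'v ugraph \<Rightarrow> 'a ugraph \<Rightarrow> ('v \<Rightarrow> 'a) set" where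
  "embs H G \<equiv> embeddings (verts H) (adj H) (verts G) (adj G)"

lemma finite_embeddings: "finite W \<Longrightarrow> finite V \<Longrightarrow> finite (embeddings W A V E)"
  by (rule finite_subset[of _ "W \<rightarrow>\<^sub>E V"]) (auto simp: embeddings_def intro: finite_PiE)

lemma graph_iso_iff_isos: "graph_iso S H \<longleftrightarrow> isos H S \<noteq> {}"
proof
  assume "graph_iso S H"
  then obtain f where f: "bij_betw f (verts S) (verts H)"
    "\<And>x y. x \<in> verts S \<Longrightarrow> y \<in> verts S \<Longrightarrow> {x, y} \<in> edges S \<longleftrightarrow> {f x, f y} \<in> edges H"
    unfolding graph_iso_def by blast
  let ?g = "restrict (inv_into (verts S) f) (verts H)"
  have b: "bij_betw (inv_into (verts S) f) (verts H) (verts S)" using f(1) by (rule bij_betw_inv_into)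
  have fg: "f (inv_into (verts S) f x) = x" if "x \<in> verts H" for x
    using f(1) that by (simp add: bij_betw_inv_into_right)
  have gS: "inv_into (verts S) f x \<in> verts S" if "x \<in> verts H" for x
    using b that by (auto simp: bij_betw_def)
  have "?g \<in> isos H S"
    using b gS f(2) fg by (auto simp: isos_def cong: bij_betw_cong)
  then show "isos H S \<noteq> {}" by blast
next
  assume "isos H S \<noteq> {}"
  then obtain g where g: "bij_betw g (verts H) (verts S)"
    "\<And>x y. x \<in> verts H \<Longrightarrow> y \<in> verts H \<Longrightarrow> {x, y} \<in> edges H \<longleftrightarrow> {g x, g y} \<in> edges S"
    unfolding isos_def by blast
  let ?f = "inv_into (verts H) g"
  have b: "bij_betw ?f (verts S) (verts H)" using g(1) by (rule bij_betw_inv_into)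
  have gf: "g (?f x) = x" if "x \<in> verts S" for x
    using g(1) that by (simp add: bij_betw_inv_into_right)
  have fH: "?f x \<in> verts H" if "x \<in> verts S" for x
    using b that by (auto simp: bij_betw_def)
  show "graph_iso S H" unfolding graph_iso_def
    using b g(2) gf fH by (intro exI[of _ ?f]) auto
qed

text \<open>Composition with \<open>f\<close> maps the automorphisms of \<open>H\<close> bijectively
  to the isomorphisms onto \<open>S\<close>.\<close>

lemma card_isos:
  assumes "f \<in> isos H S" "finite (verts H)"
  shows "card (isos H S) = card (isos H H)"
proof -
  let ?W = "verts H"
  have f: "bij_betw f ?W (verts S)" "\<And>x. x \<in> ?W \<Longrightarrow> f x \<in> verts S"
    "\<And>x y. x \<in> ?W \<Longrightarrow> y \<in> ?W \<Longrightarrow> {x, y} \<in> edges H \<longleftrightarrow> {f x, f y} \<in> edges S"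
    using assms(1) unfolding isos_def by auto
  let ?i = "inv_into ?W f"
  have i: "bij_betw ?i (verts S) ?W" using f(1) by (rule bij_betw_inv_into)
  have fi: "f (?i x) = x" if "x \<in> verts S" for x
    using f(1) that by (simp add: bij_betw_inv_into_right)
  have fl: "?i (f x) = x" if "x \<in> ?W" for x
    using f(1) that by (simp add: bij_betw_inv_into_left)
  have iW: "?i x \<in> ?W" if "x \<in> verts S" for x
    using i that by (auto simp: bij_betw_def)
  have "bij_betw (\<lambda>p. restrict (f \<circ> p) ?W) (isos H H) (isos H S)"
  proof (rule bij_betw_byWitness[where f' = "\<lambda>g. restrict (?i \<circ> g) ?W"])
    show "\<forall>p\<in>isos H H. restrict (?i \<circ> restrict (f \<circ> p) ?W) ?W = p"
      using fl by (force simp: isos_def PiE_iff extensional_def fun_eq_iff)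
    show "\<forall>g\<in>isos H S. restrict (f \<circ> restrict (?i \<circ> g) ?W) ?W = g"
      using fi by (force simp: isos_def PiE_iff extensional_def fun_eq_iff)
    show "(\<lambda>p. restrict (f \<circ> p) ?W) ` isos H H \<subseteq> isos H S"
    proof (rule image_subsetI)
      fix p assume p: "p \<in> isos H H"
      then have pW: "\<And>x. x \<in> ?W \<Longrightarrow> p x \<in> ?W" and pb: "bij_betw p ?W ?W" by (auto simp: isos_def)
      have "bij_betw (f \<circ> p) ?W (verts S)" using pb f(1) by (rule bij_betw_trans)
      then have "bij_betw (restrict (f \<circ> p) ?W) ?W (verts S)" by (simp cong: bij_betw_cong)
      then show "restrict (f \<circ> p) ?W \<in> isos H S"
        using p pW f(2,3) by (auto simp: isos_def)
    qed
    show "(\<lambda>g. restrict (?i \<circ> g) ?W) ` isos H S \<subseteq> isos H H"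
    proof (rule image_subsetI)
      fix g assume g: "g \<in> isos H S"
      then have gS: "\<And>x. x \<in> ?W \<Longrightarrow> g x \<in> verts S" and gb: "bij_betw g ?W (verts S)" by (auto simp: isos_def)
      have "bij_betw (?i \<circ> g) ?W ?W" using gb i by (rule bij_betw_trans)
      then have "bij_betw (restrict (?i \<circ> g) ?W) ?W ?W" by (simp cong: bij_betw_cong)
      moreover have "{?i (g x), ?i (g y)} \<in> edges H \<longleftrightarrow> {x, y} \<in> edges H"
        if "x \<in> ?W" "y \<in> ?W" for x y
        using g that f(3)[OF iW iW, OF gS gS, OF that] fi[OF gS] by (auto simp: isos_def)
      ultimately show "restrict (?i \<circ> g) ?W \<in> isos H H"
        using gS iW by (auto simp: isos_def)
    qed
  qed
  then show ?thesis by (metis bij_betw_same_card)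
qed

lemma isos_refl: "restrict id (verts H) \<in> isos H H"
  by (auto simp: isos_def bij_betw_def inj_on_def)

lemma card_isos_refl_pos:
  assumes "finite (verts H)"
  shows "card (isos H H) > 0"
proof -
  have "finite (isos H H)"
    by (rule finite_subset[of _ "verts H \<rightarrow>\<^sub>E verts H"]) (use assms in \<open>auto simp: isos_def intro: finite_PiE\<close>)
  then show ?thesis using isos_refl by (auto simp: card_gt_0_iff)
qed

lemma isos_image_unique:
  assumes "f \<in> isos H S" "f \<in> isos H T" "simple_graph S" "simple_graph T"
  shows "S = T"
proof -
  have sub: "edges S \<subseteq> edges T"
    if "f \<in> isos H S" "f \<in> isos H T" "simple_graph S" for S T
  proof
    fix e assume e: "e \<in> edges S"
    then have "e \<subseteq> verts S" "card e = 2" using that(3) by (auto simp: simple_graph_def)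
    then obtain a b where ab: "e = {a, b}" "a \<in> verts S" "b \<in> verts S" by (auto simp: card_2_iff)
    have "verts S = f ` verts H" using that(1) by (auto simp: isos_def bij_betw_def)
    then obtain x y where "x \<in> verts H" "y \<in> verts H" "a = f x" "b = f y" using ab by auto
    then show "e \<in> edges T" using that(1,2) e ab by (auto simp: isos_def)
  qed
  have "verts S = verts T" using assms(1,2) by (auto simp: isos_def bij_betw_def)
  moreover have "edges S = edges T" using sub assms by blast
  ultimately show ?thesis by (cases S; cases T) simp
qed

text \<open>Embeddings are grouped by their image subgraph, which the map determines. Each group has
  as many members as \<open>H\<close> has automorphisms, a positive factor independent of the host,
  so copies may be compared through embeddings.\<close>

lemma card_embs:
  assumes H: "simple_graph H" and G: "simple_graph G"
  shows "card (embs H G) = num_copies H G * card (isos H H)"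
proof -
  let ?C = "{S. subgraph S G \<and> graph_iso S H}"
  have fG: "finite (verts G)" and fH: "finite (verts H)" using assms by (auto simp: simple_graph_def)
  have fe: "finite (edges G)"
    using G by (intro finite_subset[of "edges G" "Pow (verts G)"]) (auto simp: simple_graph_def)
  have finC: "finite ?C"
  proof (rule finite_subset)
    show "?C \<subseteq> (\<lambda>(V, E). UGraph V E) ` (Pow (verts G) \<times> Pow (edges G))"
    proof
      fix S assume "S \<in> ?C"
      then have "(verts S, edges S) \<in> Pow (verts G) \<times> Pow (edges G)" by (auto simp: subgraph_def)
      then have "(\<lambda>(V, E). UGraph V E) (verts S, edges S) \<in>
          (\<lambda>(V, E). UGraph V E) ` (Pow (verts G) \<times> Pow (edges G))"
        by (rule imageI)
      then show "S \<in> (\<lambda>(V, E). UGraph V E) ` (Pow (verts G) \<times> Pow (edges G))" by simp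
    qed
  qed (use fG fe in simp)
  have fI: "finite (isos H S)" if "S \<in> ?C" for S
  proof (rule finite_subset)
    show "isos H S \<subseteq> verts H \<rightarrow>\<^sub>E verts S" by (auto simp: isos_def)
    show "finite (verts H \<rightarrow>\<^sub>E verts S)"
      using that fH by (intro finite_PiE) (auto simp: subgraph_def simple_graph_def)
  qed
  have eq: "embs H G = (\<Union>S\<in>?C. isos H S)"
  proof (intro equalityI subsetI)
    fix f assume f: "f \<in> embs H G"
    then have inj: "inj_on f (verts H)" and ed: "\<And>x y. x \<in> verts H \<Longrightarrow> y \<in> verts H \<Longrightarrow> {x, y} \<in> edges H \<Longrightarrow> {f x, f y} \<in> edges G"
      and fV: "\<And>x. x \<in> verts H \<Longrightarrow> f x \<in> verts G" and ext: "f \<in> extensional (verts H)"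
      by (auto simp: embeddings_def PiE_iff)
    \<comment> \<open>Only images of edges of \<open>H\<close> are taken, since copies need not be
      induced.\<close>
    let ?S = "UGraph (f ` verts H) ((`) f ` edges H)"
    have eH: "e \<subseteq> verts H \<and> card e = 2" if "e \<in> edges H" for e
      using H that by (auto simp: simple_graph_def)
    have sS: "simple_graph ?S"
      unfolding simple_graph_def
    proof (intro conjI ballI)
      show "finite (verts ?S)" using fH by simp
      fix e assume "e \<in> edges ?S"
      then obtain e' where e': "e' \<in> edges H" "e = f ` e'" by auto
      have "inj_on f e'" using inj eH[OF e'(1)] inj_on_subset by blast
      then show "e \<subseteq> verts ?S" "card e = 2" using eH[OF e'(1)] e'(2) by (auto simp: card_image)
    qed
    have "f ` e \<in> edges G" if e: "e \<in> edges H" for e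
    proof -
      obtain a b where ab: "e = {a, b}" using eH[OF e] by (auto simp: card_2_iff)
      then have "{f a, f b} \<in> edges G" using ed[of a b] eH[OF e] e by simp
      then show ?thesis by (simp add: ab)
    qed
    then have "subgraph ?S G" using sS fV by (auto simp: subgraph_def)
    moreover have iso: "f \<in> isos H ?S"
    proof -
      have "{x, y} \<in> edges H \<longleftrightarrow> {f x, f y} \<in> (`) f ` edges H" if xy: "x \<in> verts H" "y \<in> verts H" for x y
      proof
        assume "{x, y} \<in> edges H"
        then show "{f x, f y} \<in> (`) f ` edges H" by (intro image_eqI[of _ _ "{x, y}"]) auto
      next
        assume "{f x, f y} \<in> (`) f ` edges H"
        then obtain e where e: "e \<in> edges H" "f ` {x, y} = f ` e" by auto
        then have "{x, y} = e" using inj eH[OF e(1)] xy by (intro inj_on_image_eq_iff[THEN iffD1, OF inj]) auto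
        then show "{x, y} \<in> edges H" using e by simp
      qed
      then show ?thesis using inj ext by (auto simp: isos_def bij_betw_def PiE_iff)
    qed
    moreover have "graph_iso ?S H" using iso graph_iso_iff_isos by blast
    ultimately show "f \<in> (\<Union>S\<in>?C. isos H S)" by blast
  next
    fix f assume "f \<in> (\<Union>S\<in>?C. isos H S)"
    then obtain S where S: "subgraph S G" "f \<in> isos H S" by blast
    then show "f \<in> embs H G"
      by (auto simp: embeddings_def isos_def subgraph_def bij_betw_def PiE_iff)
  qed
  have "card (embs H G) = (\<Sum>S\<in>?C. card (isos H S))"
    unfolding eq
  proof (rule card_UN_disjoint[OF finC])
    show "\<forall>S\<in>?C. finite (isos H S)" using fI by blast
    show "\<forall>S\<in>?C. \<forall>T\<in>?C. S \<noteq> T \<longrightarrow> isos H S \<inter> isos H T = {}"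
      using isos_image_unique unfolding subgraph_def by blast
  qed
  also have "\<dots> = (\<Sum>S\<in>?C. card (isos H H))"
    using card_isos[OF _ fH] graph_iso_iff_isos[of _ H] by (intro sum.cong refl) blast
  also have "\<dots> = num_copies H G * card (isos H H)" by (simp add: num_copies_def)
  finally show ?thesis .
qed

lemma num_copies_le_iff_embs:
  assumes "simple_graph H" "simple_graph G" "simple_graph G'"
  shows "num_copies H G \<le> num_copies H G' \<longleftrightarrow> card (embs H G) \<le> card (embs H G')"
  using card_isos_refl_pos[of H] assms by (simp add: card_embs simple_graph_def[of H])

lemma contains_complete_graph:
  assumes "simple_graph G" "S \<in> cliques (adj G) k (verts G)"
  shows "contains_copy G (complete_graph k)"
proof -
  have SV: "S \<subseteq> verts G" and cS: "card S = k"
    and adjS: "\<And>x y. x \<in> S \<Longrightarrow> y \<in> S \<Longrightarrow> x \<noteq> y \<Longrightarrow> {x, y} \<in> edges G"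
    using assms(2) by (auto simp: cliques_def)
  have fS: "finite S" using SV assms(1) finite_subset by (auto simp: simple_graph_def)
  let ?S = "UGraph S {{x, y} | x y. x \<in> S \<and> y \<in> S \<and> x \<noteq> y}"
  have "subgraph ?S G"
    using SV adjS fS by (auto simp: subgraph_def simple_graph_def)
  moreover obtain f where f: "bij_betw f S {..<k}"
    using finite_same_card_bij[OF fS, of "{..<k}"] cS by auto
  have "graph_iso ?S (complete_graph k)"
    unfolding graph_iso_def
  proof (intro exI conjI ballI)
    show "bij_betw f (verts ?S) (verts (complete_graph k))"
      using f by (simp add: complete_graph_def)
    fix x y assume xy: "x \<in> verts ?S" "y \<in> verts ?S"
    then have "{x, y} \<in> edges ?S \<longleftrightarrow> x \<noteq> y" by (auto simp: doubleton_eq_iff)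
    also have "\<dots> \<longleftrightarrow> f x \<noteq> f y" using xy f by (auto simp: bij_betw_def inj_on_def)
    also have "\<dots> \<longleftrightarrow> {f x, f y} \<in> edges (complete_graph k)"
      using xy f by (auto simp: complete_graph_def bij_betw_def doubleton_eq_iff)
    finally show "{x, y} \<in> edges ?S \<longleftrightarrow> {f x, f y} \<in> edges (complete_graph k)" .
  qed
  ultimately show ?thesis by (auto simp: contains_copy_def)
qed

lemma clique_of_complete_graph:
  assumes "contains_copy G (complete_graph k)"
  shows "cliques (adj G) k (verts G) \<noteq> {}"
proof -
  obtain S where S: "subgraph S G" "graph_iso S (complete_graph k)"
    using assms by (auto simp: contains_copy_def)
  then obtain f where f: "bij_betw f (verts S) {..<k}"
    "\<And>x y. x \<in> verts S \<Longrightarrow> y \<in> verts S \<Longrightarrow> {x, y} \<in> edges S \<longleftrightarrow> {f x, f y} \<in> edges (complete_graph k)"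
    by (auto simp: graph_iso_def complete_graph_def)
  have "card (verts S) = k" using f(1) bij_betw_same_card by fastforce
  moreover have "{x, y} \<in> edges G" if "x \<in> verts S" "y \<in> verts S" "x \<noteq> y" for x y
  proof -
    have "f x \<noteq> f y" "f x < k" "f y < k" using f(1) that by (auto simp: bij_betw_def inj_on_def)
    then have "{x, y} \<in> edges S" using f(2)[OF that(1,2)] by (auto simp: complete_graph_def)
    then show ?thesis using S(1) by (auto simp: subgraph_def)
  qed
  ultimately have "verts S \<in> cliques (adj G) k (verts G)"
    using S(1) by (auto simp: cliques_def subgraph_def)
  then show ?thesis by blast
qed

subsection \<open>Graphs tiled by cliques\<close>

text \<open>The classes of \<open>idx\<close> are cliques, \<open>s\<close> of them meeting all \<open>q\<close> colours and the last one (index \<open>s\<close>)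
  meeting the first \<open>t\<close> colours. The vertex \<open>u\<close> is the only one that may have additional
  non-neighbours in the tile \<open>l\<^sub>0\<close>.\<close>

locale clique_tiling =
  fixes W :: "'v set" and A :: "'v \<Rightarrow> 'v \<Rightarrow> bool" and col idx :: "'v \<Rightarrow> nat"
    and q s t l\<^sub>0 :: nat and u :: 'v
  assumes finW: "finite W"
    and inj: "inj_on (\<lambda>x. (col x, idx x)) W"
    and colq: "x \<in> W \<Longrightarrow> col x < q"
    and idxs: "x \<in> W \<Longrightarrow> idx x \<le> s"
    and full: "l < s \<Longrightarrow> i < q \<Longrightarrow> \<exists>x\<in>W. col x = i \<and> idx x = l"
    and last: "i < t \<Longrightarrow> \<exists>x\<in>W. col x = i \<and> idx x = s"
    and last_col: "x \<in> W \<Longrightarrow> idx x = s \<Longrightarrow> col x < t"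
    and tq: "t \<le> q"
    and tile: "x \<in> W \<Longrightarrow> y \<in> W \<Longrightarrow> idx x = idx y \<Longrightarrow> x \<noteq> y \<Longrightarrow> A x y"
    and proper: "x \<in> W \<Longrightarrow> y \<in> W \<Longrightarrow> A x y \<Longrightarrow> col x \<noteq> col y"
    and root: "x \<in> W \<Longrightarrow> y \<in> W \<Longrightarrow> x \<noteq> u \<Longrightarrow> idx y = l\<^sub>0 \<Longrightarrow> col x \<noteq> col y \<Longrightarrow> A x y"
    and l0: "l\<^sub>0 < s" and idxu: "idx u < s"
begin

definition P :: "nat \<Rightarrow> 'v set" where "P l = {x \<in> W. idx x = l}"

lemma P_subset: "P l \<subseteq> W" by (auto simp: P_def)

lemma finP: "finite (P l)" using finW by (auto simp: P_def)

lemma inj_col_P: "inj_on col (P l)"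
  using inj by (auto simp: inj_on_def P_def)

lemma col_P: "l < s \<Longrightarrow> col ` P l = {..<q}"
  using full colq by (fastforce simp: P_def)

lemma col_P_last: "col ` P s = {..<t}"
  using last last_col by (fastforce simp: P_def)

lemma card_P: "l \<le> s \<Longrightarrow> card (P l) = (if l < s then q else t)"
  using card_image[OF inj_col_P, of l] col_P[of l] col_P_last by auto

text \<open>Permutations of the colours, acting inside every tile; \<open>k\<close> has to preserve
  the first \<open>t\<close> colours because the last tile has no others. These maps need not
  preserve \<open>A\<close>: in a complete multipartite host only the distinctness of colours
  matters. Their number is never computed, as it is the same factor in the upper and the lower
  bound.\<close>

definition colour_perms :: "('v \<Rightarrow> 'v) set" where
  "colour_perms = {p \<in> W \<rightarrow>\<^sub>E W. \<exists>k. inj_on k {..<q} \<and> k ` {..<q} \<subseteq> {..<q} \<and>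
     (\<forall>x\<in>W. idx (p x) = idx x \<and> col (p x) = k (col x))}"

lemma fin_colour_perms: "finite colour_perms"
  by (rule finite_subset[of _ "W \<rightarrow>\<^sub>E W"]) (use finW in \<open>auto simp: colour_perms_def intro: finite_PiE\<close>)

definition tiles :: "('v \<Rightarrow> 'a) \<Rightarrow> 'a set list" where
  "tiles f = map (\<lambda>l. f ` P l) [0..<Suc s]"

lemma tiles_nth: "i \<le> s \<Longrightarrow> tiles f ! i = f ` P i"
  using nth_upt[of 0 i "Suc s"] by (simp add: tiles_def del: upt_Suc)

lemma length_tiles: "length (tiles f) = Suc s" by (simp add: tiles_def)

lemma tiles_in_clique_tuples:
  assumes "f \<in> embeddings W A V E"
  shows "tiles f \<in> clique_tuples E q t s V"
  unfolding clique_tuples_iff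
proof (intro conjI allI impI length_tiles)
  have f: "inj_on f W" "f ` W \<subseteq> V" using assms by (auto simp: embeddings_def)
  show "tiles f ! i \<in> cliques E (if i < s then q else t) V" if "i \<le> s" for i
  proof -
    have "card (f ` P i) = card (P i)" using f(1) P_subset by (metis card_image inj_on_subset)
    moreover have "E (f x) (f y)" if "x \<in> P i" "y \<in> P i" "f x \<noteq> f y" for x y
      using assms tile[of x y] that by (auto simp: embeddings_def P_def)
    moreover have "f ` P i \<subseteq> V" using f(2) P_subset by blast
    ultimately show ?thesis
      unfolding tiles_nth[OF that] using card_P[OF that] by (auto simp: cliques_def)
  qed
  show "tiles f ! i \<inter> tiles f ! j = {}" if "i \<le> s" "j \<le> s" "i \<noteq> j" for i j
    using that f(1) unfolding tiles_nth[OF that(1)] tiles_nth[OF that(2)]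
    by (auto simp: P_def inj_on_def)
qed

text \<open>The image of a full tile is a q-clique, and a vertex adjacent to all of it would
  complete a clique of \<open>Suc q\<close> vertices.\<close>

lemma no_extended_tile:
  assumes "finite V" "symp E" "cliques E (Suc q) V = {}" "f \<in> embeddings W A V E"
    and "l < s" "w \<in> W" "idx w \<noteq> l"
  shows "\<exists>y\<in>P l. \<not> E (f w) (f y)"
proof (rule ccontr)
  assume "\<not> ?thesis"
  then have adj: "E (f w) (f y)" if "y \<in> P l" for y using that by blast
  have f: "inj_on f W" "f ` W \<subseteq> V" using assms(4) by (auto simp: embeddings_def)
  have wP: "w \<notin> P l" using assms(7) by (simp add: P_def)
  have "card (f ` insert w (P l)) \<le> q"
  proof (rule card_clique_le[OF assms(1,3)])
    show "f ` insert w (P l) \<subseteq> V" using f(2) assms(6) P_subset by blast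
    have "E (f x) (f y)" if "x \<in> P l" "y \<in> P l" "f x \<noteq> f y" for x y
      using assms(4) tile[of x y] that by (auto simp: embeddings_def P_def)
    then show "E x y" if "x \<in> f ` insert w (P l)" "y \<in> f ` insert w (P l)" "x \<noteq> y" for x y
      using that adj sympD[OF assms(2)] by blast
  qed
  moreover have "card (f ` insert w (P l)) = Suc q"
  proof -
    have "inj_on f (insert w (P l))" using f(1) assms(6) P_subset by (meson inj_on_subset insert_subset)
    then show ?thesis using wP finP card_P[of l] assms(5) by (simp add: card_image)
  qed
  ultimately show False by simp
qed

lemma root_neighbour:
  assumes "f \<in> embeddings W A V E" "x \<in> W" "x \<noteq> u" "z \<in> P l\<^sub>0" "col x \<noteq> col z"
  shows "E (f x) (f z)"
  using assms root[of x z] by (auto simp: embeddings_def P_def)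

text \<open>By \<open>no_extended_tile\<close> some non-adjacency to the root tile exists, and for
  \<open>x \<noteq> u\<close> all vertices of the tile but \<open>z\<close> are excluded by
  \<open>root_neighbour\<close>. For \<open>x = u\<close> the roles are exchanged: \<open>z\<close>
  has a non-neighbour in the full tile of \<open>u\<close>, and every vertex of that tile except
  \<open>u\<close> differs from \<open>z\<close> in colour, hence is adjacent to it.\<close>

lemma root_non_neighbour:
  assumes "finite V" "symp E" "cliques E (Suc q) V = {}" "f \<in> embeddings W A V E"
    and "x \<in> W" "idx x \<noteq> l\<^sub>0" "z \<in> P l\<^sub>0" "col x = col z"
  shows "\<not> E (f x) (f z)"
proof (cases "x = u")
  case False
  obtain y where y: "y \<in> P l\<^sub>0" "\<not> E (f x) (f y)"
    using no_extended_tile[OF assms(1-4) l0 assms(5,6)] by blast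
  then have "col x = col y" using root_neighbour[OF assms(4,5) False] by blast
  then have "y = z" using y(1) assms(7,8) inj_col_P[of l\<^sub>0] by (auto simp: inj_on_def)
  then show ?thesis using y by simp
next
  case True
  have z: "z \<in> W" "idx z \<noteq> idx u" using assms(6,7) True by (auto simp: P_def)
  obtain y where y: "y \<in> P (idx u)" "\<not> E (f z) (f y)"
    using no_extended_tile[OF assms(1-4) idxu z] by blast
  have "y = u"
  proof (rule ccontr)
    assume "y \<noteq> u"
    moreover from this have "col y \<noteq> col z"
      using inj_col_P[of "idx u"] y(1) assms(5,8) True by (auto simp: inj_on_def P_def)
    ultimately have "E (f y) (f z)"
      using y(1) assms(7) by (intro root_neighbour[OF assms(4)]) (auto simp: P_def)
    then show False using y(2) sympD[OF assms(2)] by blast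
  qed
  then show ?thesis using y(2) True sympD[OF assms(2)] by blast
qed

text \<open>In the host graph a vertex outside the image of the tile \<open>l\<^sub>0\<close> has a non-neighbour there, namely the
  vertex of its own colour. Hence the placement of the tile \<open>l\<^sub>0\<close> and the vertex sets of the
  other tiles determine the embedding.\<close>

lemma same_tiles_colour_perm:
  assumes "finite V" "symp E" "cliques E (Suc q) V = {}"
    and f: "f \<in> embeddings W A V E" and g: "g \<in> embeddings W A V E" and tl: "tiles f = tiles g"
  shows "\<exists>p\<in>colour_perms. \<forall>x\<in>W. g x = f (p x)"
proof -
  note fV = assms(1-3)
  have "\<exists>y\<in>W. idx y = idx x \<and> g x = f y" if "x \<in> W" for x
  proof -
    have "g x \<in> g ` P (idx x)" using that by (auto simp: P_def)
    also have "\<dots> = f ` P (idx x)" using tl idxs[OF that] by (metis tiles_nth)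
    finally show ?thesis by (auto simp: P_def)
  qed
  then obtain p0 where p0: "\<And>x. x \<in> W \<Longrightarrow> p0 x \<in> W \<and> idx (p0 x) = idx x \<and> g x = f (p0 x)" by metis
  define p where "p = restrict p0 W"
  have p: "p x \<in> W" "idx (p x) = idx x" "g x = f (p x)" if "x \<in> W" for x
    using p0[OF that] that by (auto simp: p_def)
  have p_inj: "x = y" if "x \<in> W" "y \<in> W" "p x = p y" for x y
    using p(3)[OF that(1)] p(3)[OF that(2)] that g by (auto simp: embeddings_def inj_on_def)
  have p_surj: "\<exists>x\<in>P l. p x = y" if "y \<in> P l" for y l
  proof -
    have "p ` P l \<subseteq> P l" using p by (auto simp: P_def)
    moreover have "inj_on p (P l)" using p_inj P_subset by (auto simp: inj_on_def)
    ultimately have "p ` P l = P l" using finP endo_inj_surj by blast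
    then have "y \<in> p ` P l" using that by simp
    then show ?thesis by blast
  qed
  have colP_eq: "x = y" if "x \<in> P l" "y \<in> P l" "col x = col y" for x y l
    using inj_col_P[of l] that by (auto simp: inj_on_def)
  have "\<exists>z\<in>P l\<^sub>0. col z = i" if "i < q" for i using full[OF l0 that] by (auto simp: P_def)
  then obtain R where R: "\<And>i. i < q \<Longrightarrow> R i \<in> P l\<^sub>0 \<and> col (R i) = i" by metis
  \<comment> \<open>The colour permutation is read off from the root tile \<open>l\<^sub>0\<close>;
    it remains to see that the other tiles follow it.\<close>
  define k where "k i = col (p (R i))" for i
  have RW: "R i \<in> W" "idx (R i) = l\<^sub>0" if "i < q" for i using R[OF that] by (auto simp: P_def)
  have pR: "p (R i) \<in> P l\<^sub>0" if "i < q" for i using p RW[OF that] by (auto simp: P_def)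
  have k_inj: "inj_on k {..<q}"
  proof (rule inj_onI)
    fix i j assume ij: "i \<in> {..<q}" "j \<in> {..<q}" "k i = k j"
    then have "p (R i) = p (R j)" using colP_eq[OF pR pR] by (simp add: k_def)
    then have "R i = R j" using p_inj RW ij by simp
    then show "i = j" using R ij by (metis lessThan_iff)
  qed
  have kq: "k ` {..<q} \<subseteq> {..<q}" using colq p RW by (auto simp: k_def)
  have k_surj: "\<exists>j<q. k j = i" if "i < q" for i
    using endo_inj_surj[OF finite_lessThan kq k_inj] that by (metis imageE lessThan_iff)
  \<comment> \<open>Adjacency to the root tile is compared under \<open>f\<close> and
    \<open>g\<close>. To name the only possible non-neighbour, \<open>root_neighbour\<close> is
    needed for \<open>p x\<close> under \<open>f\<close> or for \<open>x\<close> under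
    \<open>g\<close>, so one of the two must differ from \<open>u\<close>.\<close>
  have key: "col (p x) = k (col x)" if x: "x \<in> W" "p x \<noteq> u \<or> x \<noteq> u" for x
  proof (cases "idx x = l\<^sub>0")
    case True
    then have "R (col x) = x"
      using colP_eq[of "R (col x)" l\<^sub>0 x] R[OF colq[OF x(1)]] x(1) by (auto simp: P_def)
    then show ?thesis by (simp add: k_def)
  next
    case False
    define z where "z = R (col x)"
    have z: "z \<in> P l\<^sub>0" "z \<in> W" "col z = col x" "p z \<in> P l\<^sub>0" "p z \<in> W"
      using R[OF colq[OF x(1)]] RW[OF colq[OF x(1)]] pR[OF colq[OF x(1)]] by (auto simp: z_def P_def)
    have "\<not> E (g x) (g z)" using root_non_neighbour[OF fV g x(1) False z(1)] z(3) by simp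
    then have n: "\<not> E (f (p x)) (f (p z))" using p x(1) z(2) by simp
    have "col (p x) = col (p z)"
    proof (cases "p x = u")
      case False
      then show ?thesis using n root_neighbour[OF f p(1)[OF x(1)] False z(4)] by blast
    next
      case True
      then have xu: "x \<noteq> u" using x(2) by simp
      \<comment> \<open>With \<open>p x = u\<close> the argument runs backwards: \<open>v\<close> is
        the root vertex coloured like \<open>u\<close>, and its preimage under \<open>p\<close>
        turns out to be \<open>z\<close>.\<close>
      define v where "v = R (col (p x))"
      have cp: "col (p x) < q" using colq p(1) x(1) by blast
      have v: "v \<in> P l\<^sub>0" "col v = col (p x)" using R[OF cp] by (auto simp: v_def)
      obtain v' where v': "v' \<in> P l\<^sub>0" "p v' = v" using p_surj[OF v(1)] by blast
      have "\<not> E (f (p x)) (f v)"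
        using root_non_neighbour[OF fV f p(1)[OF x(1)] _ v(1)] v(2) p(2)[OF x(1)] False by simp
      moreover have "g v' = f v" using p(3) v' P_subset by blast
      ultimately have "\<not> E (g x) (g v')" using p(3)[OF x(1)] by simp
      then have "col x = col v'" using root_neighbour[OF g x(1) xu v'(1)] by blast
      then have "v' = z" using colP_eq z(1,3) v'(1) by simp
      then show ?thesis using v' v by simp
    qed
    then show ?thesis by (simp add: k_def z_def)
  qed
  have "col (p x) = k (col x)" if x: "x \<in> W" for x
  proof (cases "p x = u \<and> x = u")
    case False
    then show ?thesis using key[OF x] by blast
  next
    case True
    then have u: "u \<in> W" "p u = u" using x by auto
    \<comment> \<open>The remaining case \<open>p u = u\<close> is settled by counting: some vertex
      \<open>y\<close> in the tile of \<open>u\<close> has a colour that \<open>k\<close> sends to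
      \<open>col u\<close>. If \<open>y\<close> were not \<open>u\<close>, then \<open>key\<close>
      would give \<open>p y = u = p u\<close>.\<close>
    obtain j where j: "j < q" "k j = col u" using k_surj[OF colq[OF u(1)]] by blast
    obtain y where y: "y \<in> W" "col y = j" "idx y = idx u" using full[OF idxu j(1)] by blast
    have "y = u"
    proof (rule ccontr)
      assume yu: "y \<noteq> u"
      then have "col (p y) = col u" using key[of y] y j by simp
      then have "p y = u" using colP_eq[of "p y" "idx u" u] p[OF y(1)] y u by (simp add: P_def)
      then show False using p_inj[OF y(1) u(1)] u(2) yu by simp
    qed
    then show ?thesis using y(2) j(2) u(2) True by simp
  qed
  then have "p \<in> colour_perms"
    using p(1,2) k_inj kq by (auto simp: colour_perms_def p_def)
  then show ?thesis using p(3) by blast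
qed

lemma card_embeddings_le:
  assumes "finite V" "symp E" "cliques E (Suc q) V = {}"
  shows "card (embeddings W A V E) \<le> card (clique_tuples E q t s V) * card colour_perms"
proof -
  let ?T = "clique_tuples E q t s V"
  let ?F = "\<lambda>\<tau>. {g \<in> embeddings W A V E. tiles g = \<tau>}"
  have fibre: "card (?F \<tau>) \<le> card colour_perms" for \<tau>
  proof (cases "?F \<tau> = {}")
    case False
    then obtain f where f: "f \<in> embeddings W A V E" "tiles f = \<tau>" by blast
    have "?F \<tau> \<subseteq> (\<lambda>p. restrict (f \<circ> p) W) ` colour_perms"
    proof
      fix g assume g: "g \<in> ?F \<tau>"
      then obtain p where p: "p \<in> colour_perms" "\<And>x. x \<in> W \<Longrightarrow> g x = f (p x)"
        using same_tiles_colour_perm[OF assms f(1), of g] f(2) by auto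
      have "g \<in> extensional W" using g by (auto simp: embeddings_def PiE_iff)
      then have "g = restrict (f \<circ> p) W" using p(2) by (auto simp: extensional_def fun_eq_iff)
      then show "g \<in> (\<lambda>p. restrict (f \<circ> p) W) ` colour_perms" using p(1) by blast
    qed
    then show ?thesis using fin_colour_perms by (rule surj_card_le[rotated])
  next
    case True
    then show ?thesis by (simp only: card.empty)
  qed
  have "embeddings W A V E \<subseteq> (\<Union>\<tau>\<in>?T. ?F \<tau>)" using tiles_in_clique_tuples by blast
  moreover have "finite (\<Union>\<tau>\<in>?T. ?F \<tau>)"
    using finite_clique_tuples[OF assms(1)] finite_embeddings[OF finW assms(1)] by auto
  ultimately have "card (embeddings W A V E) \<le> card (\<Union>\<tau>\<in>?T. ?F \<tau>)" by (intro card_mono)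
  also have "\<dots> \<le> (\<Sum>\<tau>\<in>?T. card (?F \<tau>))"
    using finite_clique_tuples[OF assms(1)] by (rule card_UN_le)
  also have "\<dots> \<le> (\<Sum>\<tau>\<in>?T. card colour_perms)" using fibre by (intro sum_mono)
  finally show ?thesis by simp
qed

text \<open>Every tuple is the tile list of some embedding, found by matching colours. Its
  composites with colour permutations are embeddings as well, since adjacent vertices keep distinct
  colours and the host is complete between colours. So the fibres attain the bound used in
  \<open>card_embeddings_le\<close>.\<close>

lemma card_embeddings_ge:
  assumes "balanced_multipartite V E c q"
  shows "card (clique_tuples E q t s V) * card colour_perms \<le> card (embeddings W A V E)"
proof -
  interpret T: balanced_multipartite V E c q by fact
  let ?T = "clique_tuples E q t s V"
  let ?F = "\<lambda>\<tau>. {g \<in> embeddings W A V E. tiles g = \<tau>}"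
  have finF: "finite (?F \<tau>)" for \<tau> using finite_embeddings[OF finW T.fin] by simp
  have fibre: "card colour_perms \<le> card (?F \<tau>)" if "\<tau> \<in> ?T" for \<tau>
  proof -
    have len: "length \<tau> = Suc s"
      and cl: "\<And>l. l \<le> s \<Longrightarrow> \<tau> ! l \<in> cliques E (if l < s then q else t) V"
      and disj: "\<And>l m. l \<le> s \<Longrightarrow> m \<le> s \<Longrightarrow> l \<noteq> m \<Longrightarrow> \<tau> ! l \<inter> \<tau> ! m = {}"
      using that unfolding clique_tuples_iff by auto
    have \<tau>V: "\<tau> ! l \<subseteq> V" and card\<tau>: "card (\<tau> ! l) = (if l < s then q else t)" if "l \<le> s" for l
      using cl[OF that] by (auto simp: cliques_def)
    have inj\<tau>: "inj_on c (\<tau> ! l)" if "l \<le> s" for l using T.inj_on_clique cl[OF that] by blast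
    have full\<tau>: "c ` (\<tau> ! l) = {..<q}" if "l < s" for l
      using T.colours_full_clique cl[of l] that by simp
    let ?C = "c ` (\<tau> ! s)"
    have Cq: "?C \<subseteq> {..<q}" using \<tau>V[of s] T.col by auto
    have cardC: "card ?C = t" using inj\<tau>[of s] card\<tau>[of s] by (simp add: card_image)
    have fC: "finite ?C" using Cq finite_subset by blast
    obtain r1 where r1: "bij_betw r1 {..<t} ?C"
      using finite_same_card_bij[of "{..<t}" ?C] fC cardC by auto
    have "card {t..<q} = card ({..<q} - ?C)" using Cq fC cardC by (simp add: card_Diff_subset)
    then obtain r2 where r2: "bij_betw r2 {t..<q} ({..<q} - ?C)"
      using finite_same_card_bij[of "{t..<q}" "{..<q} - ?C"] by auto
    \<comment> \<open>\<open>r\<close> aligns the colours: the first \<open>t\<close> colours of the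
      pattern go to the colours present in the last clique, so that the vertices of the last tile
      find their places.\<close>
    define r where "r i = (if i < t then r1 i else r2 i)" for i
    have "bij_betw r ({..<t} \<union> {t..<q}) (?C \<union> ({..<q} - ?C))"
    proof (rule bij_betw_combine)
      show "bij_betw r {..<t} ?C" using r1 by (subst bij_betw_cong[of _ _ r1]) (auto simp: r_def)
      show "bij_betw r {t..<q} ({..<q} - ?C)" using r2 by (subst bij_betw_cong[of _ _ r2]) (auto simp: r_def)
    qed auto
    moreover have "{..<t} \<union> {t..<q} = {..<q}" "?C \<union> ({..<q} - ?C) = {..<q}" using tq Cq by auto
    ultimately have r: "bij_betw r {..<q} {..<q}" by simp
    have rt: "r i \<in> ?C" if "i < t" for i using r1 that by (auto simp: r_def bij_betw_def)
    have "\<exists>v\<in>\<tau> ! idx x. c v = r (col x)" if x: "x \<in> W" for x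
    proof (cases "idx x < s")
      case True
      have "r (col x) \<in> {..<q}" using r colq[OF x] by (auto simp: bij_betw_def)
      then show ?thesis using full\<tau>[OF True] by (metis imageE)
    next
      case False
      then have "idx x = s" using idxs[OF x] by simp
      then show ?thesis using rt[OF last_col[OF x]] by auto
    qed
    then obtain f where f: "\<And>x. x \<in> W \<Longrightarrow> f x \<in> \<tau> ! idx x \<and> c (f x) = r (col x)" by metis
    have r_inj: "i = j" if "r i = r j" "i < q" "j < q" for i j
      using r that by (auto simp: bij_betw_def inj_on_def)
    have f_inj: "x = y" if xy: "x \<in> W" "y \<in> W" "f x = f y" for x y
    proof -
      have "idx x = idx y"
        using f[OF xy(1)] f[OF xy(2)] disj[OF idxs idxs, OF xy(1,2)] xy(3) by fastforce
      moreover have "col x = col y" using f xy r_inj colq by metis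
      ultimately show ?thesis using inj xy by (auto simp: inj_on_def)
    qed
    have "card colour_perms = card ((\<lambda>p. restrict (f \<circ> p) W) ` colour_perms)"
    proof (rule card_image[symmetric], rule inj_onI)
      fix p p' assume p: "p \<in> colour_perms" "p' \<in> colour_perms"
        and eq: "restrict (f \<circ> p) W = restrict (f \<circ> p') W"
      show "p = p'"
      proof
        fix x
        show "p x = p' x"
        proof (cases "x \<in> W")
          case True
          then have "f (p x) = f (p' x)" using fun_cong[OF eq, of x] by simp
          moreover have "p x \<in> W" "p' x \<in> W" using p True by (auto simp: colour_perms_def)
          ultimately show ?thesis using f_inj by blast
        next
          case False
          have "p \<in> extensional W" "p' \<in> extensional W" using p by (auto simp: colour_perms_def PiE_iff)
          then show ?thesis using False by (simp add: extensional_def)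
        qed
      qed
    qed
    also have "\<dots> \<le> card (?F \<tau>)"
    proof (rule card_mono[OF finF], rule image_subsetI)
      fix p assume "p \<in> colour_perms"
      then have pW: "\<And>x. x \<in> W \<Longrightarrow> p x \<in> W" by (auto simp: colour_perms_def)
      obtain k where k: "inj_on k {..<q}" "k ` {..<q} \<subseteq> {..<q}"
        and pk: "\<And>x. x \<in> W \<Longrightarrow> idx (p x) = idx x \<and> col (p x) = k (col x)"
        using \<open>p \<in> colour_perms\<close> by (auto simp: colour_perms_def)
      let ?g = "restrict (f \<circ> p) W"
      have g\<tau>: "?g x \<in> \<tau> ! idx x" if "x \<in> W" for x using f[OF pW[OF that]] pk[OF that] that by simp
      have p_inj: "x = y" if xy: "x \<in> W" "y \<in> W" "p x = p y" for x y
      proof -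
        have "col x = col y" using pk[OF xy(1)] pk[OF xy(2)] xy(3) k(1) colq[OF xy(1)] colq[OF xy(2)]
          by (auto simp: inj_on_def)
        moreover have "idx x = idx y" using pk xy by metis
        ultimately show ?thesis using inj xy by (auto simp: inj_on_def)
      qed
      have g_inj: "inj_on ?g W" using f_inj p_inj pW by (auto simp: inj_on_def)
      have "E (?g x) (?g y)" if xy: "x \<in> W" "y \<in> W" "A x y" for x y
      proof -
        have "k (col x) \<noteq> k (col y)"
          using proper[OF xy] k(1) colq[OF xy(1)] colq[OF xy(2)] by (auto simp: inj_on_def)
        moreover have "k (col x) < q" "k (col y) < q" using k(2) colq xy by auto
        ultimately have "r (col (p x)) \<noteq> r (col (p y))" using r_inj pk xy by metis
        then have "c (?g x) \<noteq> c (?g y)" using f pW xy by simp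
        moreover have "?g x \<in> V" "?g y \<in> V" using g\<tau> \<tau>V idxs xy by blast+
        ultimately show ?thesis using T.adj by blast
      qed
      moreover have "?g \<in> W \<rightarrow>\<^sub>E V" using g\<tau> \<tau>V[OF idxs] by (auto simp: PiE_iff)
      ultimately have "?g \<in> embeddings W A V E" using g_inj by (auto simp: embeddings_def)
      moreover have "tiles ?g = \<tau>"
      proof (rule nth_equalityI)
        show "length (tiles ?g) = length \<tau>" by (simp add: length_tiles len)
        fix l assume "l < length (tiles ?g)"
        then have l: "l \<le> s" by (simp add: length_tiles)
        have "?g ` P l \<subseteq> \<tau> ! l" using g\<tau> by (auto simp: P_def)
        moreover have "card (?g ` P l) = card (\<tau> ! l)"
          using card_image[OF inj_on_subset[OF g_inj P_subset]] card_P[OF l] card\<tau>[OF l] by simp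
        moreover have "finite (\<tau> ! l)" using \<tau>V[OF l] T.fin finite_subset by blast
        ultimately show "tiles ?g ! l = \<tau> ! l" unfolding tiles_nth[OF l] by (intro card_subset_eq)
      qed
      ultimately show "?g \<in> ?F \<tau>" by simp
    qed
    finally show ?thesis .
  qed
  have "card ?T * card colour_perms = (\<Sum>\<tau>\<in>?T. card colour_perms)" by simp
  also have "\<dots> \<le> (\<Sum>\<tau>\<in>?T. card (?F \<tau>))" using fibre by (intro sum_mono)
  also have "\<dots> = card (\<Union>\<tau>\<in>?T. ?F \<tau>)"
    using finite_clique_tuples[OF T.fin] finF by (intro card_UN_disjoint[symmetric]) auto
  also have "\<dots> \<le> card (embeddings W A V E)"
    using finite_embeddings[OF finW T.fin] by (intro card_mono) auto
  finally show ?thesis .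
qed

theorem card_embeddings_le_balanced:
  assumes "finite V" "symp E" "cliques E (Suc q) V = {}" "q \<ge> 1"
    and "balanced_multipartite V' E' c q" "card V' = card V"
  shows "card (embeddings W A V E) \<le> card (embeddings W A V' E')"
proof -
  have "card (embeddings W A V E) \<le> card (clique_tuples E q t s V) * card colour_perms"
    by (rule card_embeddings_le[OF assms(1-3)])
  also have "\<dots> \<le> card (clique_tuples E' q t s V') * card colour_perms"
    using card_clique_tuples_le[OF assms(1-4)] balanced_card_clique_tuples[OF assms(5,4) tq] assms(6)
    by simp
  also have "\<dots> \<le> card (embeddings W A V' E')" by (rule card_embeddings_ge[OF assms(5)])
  finally show ?thesis .
qed

end

subsection \<open>The two families\<close>

definition tiled_graph :: "nat \<Rightarrow> nat \<Rightarrow> nat \<Rightarrow> nat \<Rightarrow> (nat \<times> nat) ugraph" where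
  "tiled_graph q s t d =
     (let K = complete_multipartite (replicate t (s + 1) @ replicate (q - t) s)
      in UGraph (verts K) (edges K - {{(0, 0), (1, j)} | j. j < d}))"

lemma G_graph_eq: "G_graph r s t = tiled_graph (r - 1) s t 0"
  by (simp add: G_graph_def tiled_graph_def Let_def)

lemma J_graph_eq: "J_graph r s d = tiled_graph (r - 1) s 0 d"
  by (simp add: J_graph_def tiled_graph_def Let_def)

lemma verts_complete_multipartite:
  "verts (complete_multipartite ks) = {(i, j). i < length ks \<and> j < ks ! i}"
  by (simp add: complete_multipartite_def)

lemma adj_complete_multipartite:
  "adj (complete_multipartite ks) x y \<longleftrightarrow>
     x \<in> verts (complete_multipartite ks) \<and> y \<in> verts (complete_multipartite ks) \<and> fst x \<noteq> fst y"
proof -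
  have e: "edges (complete_multipartite ks) = {{x, y} | x y. x \<in> verts (complete_multipartite ks) \<and>
      y \<in> verts (complete_multipartite ks) \<and> fst x \<noteq> fst y}"
    by (simp add: complete_multipartite_def Let_def)
  show ?thesis
  proof
    assume "adj (complete_multipartite ks) x y"
    then obtain a b where "{x, y} = {a, b}" "a \<in> verts (complete_multipartite ks)"
      "b \<in> verts (complete_multipartite ks)" "fst a \<noteq> fst b"
      unfolding e by blast
    then show "x \<in> verts (complete_multipartite ks) \<and> y \<in> verts (complete_multipartite ks) \<and> fst x \<noteq> fst y"
      unfolding doubleton_eq_iff by metis
  next
    assume "x \<in> verts (complete_multipartite ks) \<and> y \<in> verts (complete_multipartite ks) \<and> fst x \<noteq> fst y"
    then show "adj (complete_multipartite ks) x y" unfolding e by blast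
  qed
qed

lemma finite_verts_complete_multipartite: "finite (verts (complete_multipartite ks))"
proof -
  have "verts (complete_multipartite ks) = (SIGMA i:{..<length ks}. {..<ks ! i})"
    by (auto simp: verts_complete_multipartite)
  then show ?thesis by simp
qed

lemma simple_complete_multipartite: "simple_graph (complete_multipartite ks)"
  unfolding simple_graph_def
proof (intro conjI ballI finite_verts_complete_multipartite)
  fix e assume "e \<in> edges (complete_multipartite ks)"
  then show "e \<subseteq> verts (complete_multipartite ks)" "card e = 2"
    unfolding complete_multipartite_def Let_def by auto
qed

lemma verts_tiled_graph:
  assumes "t \<le> q"
  shows "verts (tiled_graph q s t d) = {(i, j). i < q \<and> j < s + (if i < t then 1 else 0)}"
  using assms by (auto simp: tiled_graph_def Let_def verts_complete_multipartite nth_append split: if_splits)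

lemma adj_tiled_graph:
  "adj (tiled_graph q s t d) x y \<longleftrightarrow>
     x \<in> verts (tiled_graph q s t d) \<and> y \<in> verts (tiled_graph q s t d) \<and> fst x \<noteq> fst y \<and>
     \<not> (\<exists>j<d. {x, y} = {(0, 0), (1, j)})"
  by (auto simp: tiled_graph_def Let_def adj_complete_multipartite)

lemma simple_tiled_graph: "simple_graph (tiled_graph q s t d)"
  using simple_complete_multipartite[of "replicate t (s + 1) @ replicate (q - t) s"]
  by (auto simp: simple_graph_def tiled_graph_def Let_def)

text \<open>Part 1 is reversed, so that the tile of \<open>(0, 0)\<close> contains \<open>(1, s - 1)\<close>, which is adjacent to it.\<close>

definition tile_index :: "nat \<Rightarrow> nat \<times> nat \<Rightarrow> nat" where
  "tile_index s x = (if fst x = 1 \<and> snd x < s then s - 1 - snd x else snd x)"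

text \<open>All deleted edges contain \<open>(0, 0)\<close>, which lies in tile 0, so tile 1 can be
  the root; \<open>s \<ge> 2\<close> makes it a full tile. If part 1 has a vertex
  \<open>(1, s)\<close>, the reversal leaves it in the last tile.\<close>

lemma clique_tiling_tiled_graph:
  assumes "q \<ge> 2" "t < q" "d < s" "s \<ge> 2"
  shows "clique_tiling (verts (tiled_graph q s t d)) (adj (tiled_graph q s t d))
    fst (tile_index s) q s t 1 (0, 0)"
proof -
  let ?W = "verts (tiled_graph q s t d)"
  have W: "?W = {(i, j). i < q \<and> j < s + (if i < t then 1 else 0)}"
    using assms(2) by (simp add: verts_tiled_graph)
  show ?thesis
  proof
    show "finite ?W" using simple_tiled_graph by (simp add: simple_graph_def)
    show "inj_on (\<lambda>x. (fst x, tile_index s x)) ?W"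
      using assms by (auto simp: inj_on_def tile_index_def W split: if_splits)
    show "fst x < q" if "x \<in> ?W" for x using that by (auto simp: W)
    show "tile_index s x \<le> s" if "x \<in> ?W" for x
      using that by (auto simp: W tile_index_def split: if_splits)
    show "\<exists>x\<in>?W. fst x = i \<and> tile_index s x = l" if "l < s" "i < q" for l i
      using that by (intro bexI[of _ "(i, if i = 1 then s - 1 - l else l)"]) (auto simp: W tile_index_def)
    show "\<exists>x\<in>?W. fst x = i \<and> tile_index s x = s" if "i < t" for i
      using that assms(2) by (intro bexI[of _ "(i, s)"]) (auto simp: W tile_index_def)
    show "fst x < t" if "x \<in> ?W" "tile_index s x = s" for x
      using that assms(4) by (auto simp: W tile_index_def split: if_splits)
    show "t \<le> q" "1 < s" using assms by auto
    show "tile_index s (0, 0) < s" using assms by (simp add: tile_index_def)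
    show "adj (tiled_graph q s t d) x y" if "x \<in> ?W" "y \<in> ?W" "tile_index s x = tile_index s y" "x \<noteq> y" for x y
      using that assms(3) unfolding adj_tiled_graph
      by (auto simp: W tile_index_def doubleton_eq_iff split: if_splits)
    show "fst x \<noteq> fst y" if "adj (tiled_graph q s t d) x y" for x y
      using that unfolding adj_tiled_graph by simp
    show "adj (tiled_graph q s t d) x y"
      if "x \<in> ?W" "y \<in> ?W" "x \<noteq> (0, 0)" "tile_index s y = 1" "fst x \<noteq> fst y" for x y
      using that unfolding adj_tiled_graph
      by (auto simp: tile_index_def doubleton_eq_iff split: if_splits)
  qed
qed

section \<open>Turan graphs as hosts and the positive half\<close>

lemma verts_turan_graph: "verts (turan_graph q n) = {(i, j). i < q \<and> j < (n + i) div q}"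
  by (auto simp: turan_graph_def verts_complete_multipartite)

lemma card_turan_part:
  assumes "i < q"
  shows "card {v \<in> verts (turan_graph q n). fst v = i} = (n + i) div q"
proof -
  have "{v \<in> verts (turan_graph q n). fst v = i} = Pair i ` {..<(n + i) div q}"
    using assms by (auto simp: verts_turan_graph)
  then show ?thesis by (simp add: card_image inj_on_def)
qed

lemma balanced_turan_graph:
  assumes "q > 0"
  shows "balanced_multipartite (verts (turan_graph q n)) (adj (turan_graph q n)) fst q"
proof
  show "finite (verts (turan_graph q n))"
    unfolding turan_graph_def by (rule finite_verts_complete_multipartite)
  show "fst x < q" if "x \<in> verts (turan_graph q n)" for x using that by (auto simp: verts_turan_graph)
  show "adj (turan_graph q n) x y \<longleftrightarrow> fst x \<noteq> fst y"
    if "x \<in> verts (turan_graph q n)" "y \<in> verts (turan_graph q n)" for x y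
    using that unfolding turan_graph_def adj_complete_multipartite by simp
  show "card {v \<in> verts (turan_graph q n). fst v = i} \<le> Suc (card {v \<in> verts (turan_graph q n). fst v = j})"
    if "i < q" "j < q" for i j
  proof -
    have "(n + i) div q \<le> (n + j + q) div q" using that by (intro div_le_mono) simp
    then show ?thesis using that assms by (simp add: card_turan_part)
  qed
qed

lemma card_verts_turan_graph:
  assumes "q > 0"
  shows "card (verts (turan_graph q n)) = n"
proof -
  interpret balanced_multipartite "verts (turan_graph q n)" "adj (turan_graph q n)" fst q
    by (rule balanced_turan_graph[OF assms])
  show ?thesis unfolding card_V using sum_turan_part_sizes[OF assms, of n] by (simp add: card_turan_part)
qed

theorem turan_good_tiled_graph:
  assumes "q \<ge> 2" "t < q" "d < s" "s \<ge> 2"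
  shows "turan_good (Suc q) (tiled_graph q s t d)"
  unfolding turan_good_def
proof (intro always_eventually allI impI, elim conjE)
  fix n and G :: "nat ugraph"
  assume G: "simple_graph G" "card (verts G) = n" "\<not> contains_copy G (complete_graph (Suc q))"
  interpret clique_tiling "verts (tiled_graph q s t d)" "adj (tiled_graph q s t d)"
      fst "tile_index s" q s t 1 "(0, 0)"
    using assms by (rule clique_tiling_tiled_graph)
  have q: "q > 0" using assms by simp
  have "card (embs (tiled_graph q s t d) G) \<le> card (embs (tiled_graph q s t d) (turan_graph q n))"
  proof (rule card_embeddings_le_balanced)
    show "finite (verts G)" using G(1) by (simp add: simple_graph_def)
    show "symp (adj G)" by (simp add: symp_def insert_commute)
    show "cliques (adj G) (Suc q) (verts G) = {}"
      using contains_complete_graph[OF G(1)] G(3) by blast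
    show "q \<ge> 1" using q by simp
    show "balanced_multipartite (verts (turan_graph q n)) (adj (turan_graph q n)) fst q"
      using q by (rule balanced_turan_graph)
    show "card (verts (turan_graph q n)) = card (verts G)"
      using card_verts_turan_graph[OF q] G(2) by simp
  qed
  moreover have "simple_graph (turan_graph q n)"
    by (simp add: turan_graph_def simple_complete_multipartite)
  ultimately have "num_copies (tiled_graph q s t d) G \<le> num_copies (tiled_graph q s t d) (turan_graph q n)"
    using num_copies_le_iff_embs[OF simple_tiled_graph G(1)] by blast
  then show "num_copies (tiled_graph q s t d) G \<le>
      num_copies (tiled_graph q s t d) (turan_graph (Suc q - 1) n)"
    by simp
qed

subsection \<open>Colourings with one additional colour\<close>

definition proper_colourings :: "nat \<Rightarrow> 'v ugraph \<Rightarrow> ('v \<Rightarrow> nat) set" where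
  "proper_colourings k H = {f \<in> verts H \<rightarrow>\<^sub>E {..<k}. \<forall>x y. adj H x y \<longrightarrow> f x \<noteq> f y}"

text \<open>With \<open>k * L\<close> vertices all parts have size \<open>L\<close>. An embedding is
  a proper colouring together with the positions inside the parts; dropping the injectivity of the
  positions only enlarges the count.\<close>

lemma card_embs_turan_le:
  assumes "simple_graph H" "k > 0"
  shows "card (embs H (turan_graph k (k * L))) \<le> card (proper_colourings k H) * L ^ card (verts H)"
proof -
  let ?W = "verts H" and ?T = "turan_graph k (k * L)"
  have fW: "finite ?W" using assms by (simp add: simple_graph_def)
  have T: "verts ?T = {..<k} \<times> {..<L}"
    using assms(2) by (auto simp: verts_turan_graph)
  have fC: "finite (proper_colourings k H)"
    by (rule finite_subset[of _ "?W \<rightarrow>\<^sub>E {..<k}"]) (use fW in \<open>auto simp: proper_colourings_def intro: finite_PiE\<close>)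
  let ?F = "\<lambda>f. (restrict (fst \<circ> f) ?W, restrict (snd \<circ> f) ?W)"
  have "card (embs H ?T) \<le> card (proper_colourings k H \<times> (?W \<rightarrow>\<^sub>E {..<L}))"
  proof (rule card_inj_on_le)
    show "inj_on ?F (embs H ?T)"
    proof (rule inj_onI)
      fix f g assume fg: "f \<in> embs H ?T" "g \<in> embs H ?T" and eq: "?F f = ?F g"
      show "f = g"
      proof
        fix x
        show "f x = g x"
        proof (cases "x \<in> ?W")
          case True
          have "restrict (fst \<circ> f) ?W x = restrict (fst \<circ> g) ?W x"
            "restrict (snd \<circ> f) ?W x = restrict (snd \<circ> g) ?W x"
            using eq by simp_all
          then show ?thesis using True by (simp add: prod_eq_iff)
        next
          case False
          then show ?thesis using fg by (auto simp: embeddings_def PiE_iff extensional_def)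
        qed
      qed
    qed
    show "?F ` embs H ?T \<subseteq> proper_colourings k H \<times> (?W \<rightarrow>\<^sub>E {..<L})"
    proof (rule image_subsetI)
      fix f assume f: "f \<in> embs H ?T"
      then have fV: "f x \<in> {..<k} \<times> {..<L}" if "x \<in> ?W" for x
        using that unfolding embeddings_def T by blast
      have "fst (f x) \<noteq> fst (f y)" if "adj H x y" for x y
      proof -
        have "x \<in> ?W" "y \<in> ?W" using assms(1) that by (auto simp: simple_graph_def)
        then have "adj ?T (f x) (f y)" using f that by (auto simp: embeddings_def)
        then show ?thesis unfolding turan_graph_def adj_complete_multipartite by blast
      qed
      moreover have "x \<in> ?W" "y \<in> ?W" if "adj H x y" for x y
        using assms(1) that by (auto simp: simple_graph_def)
      ultimately show "?F f \<in> proper_colourings k H \<times> (?W \<rightarrow>\<^sub>E {..<L})"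
        using fV by (fastforce simp: proper_colourings_def PiE_iff mem_Times_iff)
    qed
    show "finite (proper_colourings k H \<times> (?W \<rightarrow>\<^sub>E {..<L}))"
      using fC fW by (intro finite_cartesian_product finite_PiE) auto
  qed
  also have "\<dots> = card (proper_colourings k H) * L ^ card ?W"
    using fW by (simp add: card_cartesian_product card_funcsetE)
  finally show ?thesis .
qed

text \<open>The Turan graph with \<open>q\<close> parts of size \<open>M\<close>, realised on
  natural numbers because \<open>turan_good\<close> quantifies over such hosts.\<close>

definition residue_graph :: "nat \<Rightarrow> nat \<Rightarrow> nat ugraph" where
  "residue_graph q M = UGraph {..<q * M} {{x, y} | x y. x < q * M \<and> y < q * M \<and> x mod q \<noteq> y mod q}"

lemma adj_residue_graph:
  "adj (residue_graph q M) x y \<longleftrightarrow> x < q * M \<and> y < q * M \<and> x mod q \<noteq> y mod q"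
  by (auto simp: residue_graph_def doubleton_eq_iff)

lemma simple_residue_graph: "simple_graph (residue_graph q M)"
  by (auto simp: simple_graph_def residue_graph_def card_insert_if)

lemma residue_graph_clique_free:
  assumes "q > 0" "q < k"
  shows "\<not> contains_copy (residue_graph q M) (complete_graph k)"
proof
  assume "contains_copy (residue_graph q M) (complete_graph k)"
  then obtain S where S: "S \<in> cliques (adj (residue_graph q M)) k (verts (residue_graph q M))"
    using clique_of_complete_graph by blast
  then have "inj_on (\<lambda>x. x mod q) S"
    unfolding cliques_def adj_residue_graph by (auto simp: inj_on_def)
  then have "card S \<le> card {..<q}"
    by (rule card_inj_on_le) (use assms in auto)
  then show False using S assms by (simp add: cliques_def)
qed

text \<open>A vertex \<open>x\<close> goes to the number with residue \<open>k (c x)\<close> and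
  quotient \<open>f x\<close>, for a permutation \<open>k\<close> of the colours and an injection
  \<open>f\<close>. Surjectivity of \<open>c\<close> makes different \<open>k\<close> give different
  maps. Taking \<open>f\<close> injective on all of \<open>H\<close> loses only lower order terms in
  \<open>M\<close>.\<close>

lemma card_embs_residue_ge:
  assumes "finite (verts H)" "q > 0"
    and "c ` verts H = {..<q}" "\<And>x y. adj H x y \<Longrightarrow> c x \<noteq> (c y :: nat)"
  shows "fact q * (M - card (verts H)) ^ card (verts H) \<le> card (embs H (residue_graph q M))"
proof -
  let ?W = "verts H" and ?R = "residue_graph q M"
  let ?I = "{f \<in> ?W \<rightarrow>\<^sub>E {..<M}. inj_on f ?W}"
  let ?F = "\<lambda>(k, f). \<lambda>x\<in>?W. k (c x) + q * f x"
  have cq: "c x < q" if "x \<in> ?W" for x using that assms(3) by blast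
  have "(M - card ?W) ^ card ?W = (\<Prod>i\<in>{0..<card ?W}. M - card ?W)" by simp
  also have "\<dots> \<le> (\<Prod>i\<in>{0..<card ?W}. M - i)" by (intro prod_mono) auto
  also have "\<dots> = card ?I"
    using card_inj_on_subset_funcset[OF assms(1) finite_lessThan[of M] order_refl] by simp
  finally have "fact q * (M - card ?W) ^ card ?W \<le> card ({k. k permutes {..<q}} \<times> ?I)"
    by (simp add: card_cartesian_product card_permutations[OF _ finite_lessThan])
  also have "\<dots> \<le> card (embs H ?R)"
  proof (rule card_inj_on_le)
    have kq: "k (c x) < q" if "k permutes {..<q}" "x \<in> ?W" for k x
      using permutes_in_image[OF that(1), of "c x"] cq[OF that(2)] by simp
    show "inj_on ?F ({k. k permutes {..<q}} \<times> ?I)"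
    proof (rule inj_onI, clarify)
      fix k f k' f'
      assume k: "k permutes {..<q}" "k' permutes {..<q}"
        and f: "f \<in> ?W \<rightarrow>\<^sub>E {..<M}" "f' \<in> ?W \<rightarrow>\<^sub>E {..<M}"
        and eq: "(\<lambda>x\<in>?W. k (c x) + q * f x) = (\<lambda>x\<in>?W. k' (c x) + q * f' x)"
      have e: "k (c x) = k' (c x) \<and> f x = f' x" if x: "x \<in> ?W" for x
      proof -
        have s: "k (c x) + q * f x = k' (c x) + q * f' x" using fun_cong[OF eq, of x] x by simp
        have "(k (c x) + q * f x) mod q = k (c x)" "(k' (c x) + q * f' x) mod q = k' (c x)"
          using kq[OF k(1) x] kq[OF k(2) x] by simp_all
        then have "k (c x) = k' (c x)" using s by simp
        then show ?thesis using s assms(2) by simp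
      qed
      have "k i = k' i" for i
      proof (cases "i < q")
        case True
        then obtain x where "x \<in> ?W" "c x = i" using assms(3) by (metis imageE lessThan_iff)
        then show ?thesis using e by blast
      next
        case False
        then show ?thesis using k by (simp add: permutes_def)
      qed
      moreover have "f x = f' x" for x
        using e f by (cases "x \<in> ?W") (auto simp: PiE_iff extensional_def)
      ultimately show "k = k' \<and> f = f'" by auto
    qed
    show "?F ` ({k. k permutes {..<q}} \<times> ?I) \<subseteq> embs H ?R"
    proof (rule image_subsetI, clarify)
      fix k f assume k: "k permutes {..<q}" and f: "f \<in> ?W \<rightarrow>\<^sub>E {..<M}" "inj_on f ?W"
      let ?g = "\<lambda>x\<in>?W. k (c x) + q * f x"
      have g: "?g x mod q = k (c x)" "?g x div q = f x" "?g x < q * M" if x: "x \<in> ?W" for x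
      proof -
        show "?g x mod q = k (c x)" "?g x div q = f x" using kq[OF k x] x by simp_all
        have "Suc (f x) \<le> M" using f(1) x by (auto simp: Suc_le_eq)
        then have "q * Suc (f x) \<le> q * M" by (rule mult_le_mono2)
        then show "?g x < q * M" using kq[OF k x] x by simp
      qed
      have "inj_on ?g ?W" using f(2) g(2) unfolding inj_on_def by metis
      moreover have "adj ?R (?g x) (?g y)" if "x \<in> ?W" "y \<in> ?W" "adj H x y" for x y
      proof -
        have "k (c x) \<noteq> k (c y)" using assms(4)[OF that(3)] permutes_inj[OF k] by (simp add: inj_eq)
        then show ?thesis
          unfolding adj_residue_graph g(1)[OF that(1)] g(1)[OF that(2)]
          using g(3)[OF that(1)] g(3)[OF that(2)] by blast
      qed
      moreover have "?g \<in> ?W \<rightarrow>\<^sub>E verts ?R" using g(3) by (auto simp: residue_graph_def)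
      ultimately show "?g \<in> embs H ?R" by (simp add: embeddings_def)
    qed
    show "finite (embs H ?R)"
      using assms(1) simple_residue_graph by (intro finite_embeddings) (auto simp: simple_graph_def)
  qed
  finally show ?thesis .
qed

lemma card_verts_tiled_graph:
  assumes "t \<le> q"
  shows "card (verts (tiled_graph q s t d)) = q * s + t"
proof -
  have "verts (tiled_graph q s t d) = (SIGMA i:{..<q}. {..<s + (if i < t then 1 else 0)})"
    using assms by (auto simp: verts_tiled_graph)
  then have "card (verts (tiled_graph q s t d)) = (\<Sum>i<q. s + (if i < t then 1 else 0))"
    by simp
  also have "\<dots> = q * s + card {i. i < q \<and> i < t}"
    by (simp add: sum.distrib sum.If_cases Int_def)
  also have "{i. i < q \<and> i < t} = {..<t}" using assms by auto
  finally show ?thesis by simp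
qed

text \<open>The colourings of \<^term>\<open>tiled_graph q s t d\<close> with one colour more than needed: part \<open>a\<close> gets the
  colour \<open>p a\<close>, and the spare colour \<open>p q\<close> is used inside one part \<open>i < q\<close> only or (coded by
  \<open>i = q\<close>) on the vertex \<open>(0, 0)\<close> and on vertices \<open>(1, j)\<close> that are not adjacent to it.\<close>

definition spare_colouring :: "nat \<Rightarrow> nat \<times> (nat \<Rightarrow> nat) \<times> nat set \<Rightarrow> nat \<times> nat \<Rightarrow> nat" where
  "spare_colouring q = (\<lambda>(i, p, X) x.
     if i < q then (if fst x = i \<and> snd x \<notin> X then p q else p (fst x))
     else (if x = (0, 0) \<or> fst x = 1 \<and> snd x \<in> X then p q else p (fst x)))"

text \<open>Each part has a vertex untouched by the deleted edges. These \<open>q\<close> vertices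
  get distinct colours, which leaves one colour \<open>m\<close>, and every vertex has either the
  colour of the chosen vertex in its part or \<open>m\<close>. So a colouring is given by a
  permutation and the set of vertices coloured \<open>m\<close>.\<close>

lemma card_proper_colourings_tiled_graph_le:
  assumes "q \<ge> 2" "t < q" "d < s" "s \<ge> 2"
  shows "card (proper_colourings (Suc q) (tiled_graph q s t d)) \<le> fact (Suc q) * (2 ^ s * (Suc q + t))"
proof -
  let ?H = "tiled_graph q s t d" and ?p = "\<lambda>i. s + (if i < t then 1 else 0)"
  let ?W = "verts ?H"
  have W: "?W = {(i, j). i < q \<and> j < ?p i}"
    using assms(2) by (simp add: verts_tiled_graph)
  note adj = adj_tiled_graph[of _ _ q s t d]
  let ?I = "SIGMA i:{..q}. {p. p permutes {..<Suc q}} \<times> Pow {..<?p i}"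
  have finI: "finite ?I"
    by (intro finite_SigmaI finite_cartesian_product) (auto simp: finite_permutations)
  have "proper_colourings (Suc q) ?H \<subseteq> (\<lambda>c. restrict (spare_colouring q c) ?W) ` ?I"
  proof
    fix f assume f: "f \<in> proper_colourings (Suc q) ?H"
    have f_ext: "f x = undefined" if "x \<notin> ?W" for x
      using f that PiE_arb unfolding proper_colourings_def by fast
    have f_less: "f x < Suc q" if "x \<in> ?W" for x
      using f that PiE_mem unfolding proper_colourings_def by fast
    have f_adj: "f x \<noteq> f y" if "x \<in> ?W" "y \<in> ?W" "fst x \<noteq> fst y"
      "\<not> (\<exists>j<d. {x, y} = {(0, 0), (1, j)})" for x y
      using f that adj unfolding proper_colourings_def by blast
    \<comment> \<open>The representatives avoid \<open>(0, 0)\<close> and its non-neighbours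
      \<open>(1, j)\<close> with \<open>j < d\<close>; this is where \<open>d < s\<close> and
      \<open>s \<ge> 2\<close> enter.\<close>
    define R where "R a = (a, if a = 1 then s - 1 else 1)" for a :: nat
    have R_W: "R a \<in> ?W" if "a < q" for a using that assms(4) by (auto simp: R_def W)
    have R_nadj: "\<not> (\<exists>j<d. {R a, x} = {(0, 0), (1, j)})" for a x
      using assms(3) by (auto simp: R_def doubleton_eq_iff split: if_splits)
    have fst_R: "fst (R a) = a" for a by (simp add: R_def)
    have R_ne: "f (R a) \<noteq> f x" if "a < q" "x \<in> ?W" "a \<noteq> fst x" for a x
      using f_adj[OF R_W[OF that(1)] that(2) _ R_nadj] that(3) fst_R by simp
    define g where "g a = f (R a)" for a
    have g_inj: "inj_on g {..<q}"
    proof (rule inj_onI, rule ccontr)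
      fix a b assume "a \<in> {..<q}" "b \<in> {..<q}" "g a = g b" "a \<noteq> b"
      then show False using R_ne[of a "R b"] R_W[of b] by (simp add: g_def fst_R)
    qed
    have g_less: "g ` {..<q} \<subseteq> {..<Suc q}" using f_less[OF R_W] by (auto simp: g_def)
    have "card ({..<Suc q} - g ` {..<q}) = 1"
      using g_inj g_less by (simp add: card_Diff_subset card_image)
    then obtain m where m: "{..<Suc q} - g ` {..<q} = {m}" by (auto simp: card_1_singleton_iff)
    define p where "p a = (if a < q then g a else if a = q then m else a)" for a
    have p: "p permutes {..<Suc q}"
    proof (rule bij_imp_permutes)
      have "p ` {..<Suc q} = insert m (g ` {..<q})"
        by (auto simp: p_def lessThan_Suc image_iff)
      also have "\<dots> = {..<Suc q}" using m g_less by blast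
      finally have im: "p ` {..<Suc q} = {..<Suc q}" .
      then have "inj_on p {..<Suc q}" by (intro eq_card_imp_inj_on) auto
      then show "bij_betw p {..<Suc q} {..<Suc q}" using im by (simp add: bij_betw_def)
      show "p x = x" if "x \<notin> {..<Suc q}" for x using that by (simp add: p_def)
    qed
    have val: "f x = p (fst x) \<or> f x = m" if x: "x \<in> ?W" for x
    proof (rule ccontr)
      assume *: "\<not> ?thesis"
      have fx: "fst x < q" using x by (auto simp: W)
      have "f x \<notin> g ` {..<q}"
      proof
        assume "f x \<in> g ` {..<q}"
        then obtain a where a: "a < q" "f x = g a" by auto
        then have "a = fst x" using R_ne[OF a(1) x] by (auto simp: g_def)
        then show False using * a fx by (simp add: p_def)
      qed
      then have "f x \<in> {m}" using f_less[OF x] m by blast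
      then show False using * by simp
    qed
    have pq: "p q = m" by (simp add: p_def)
    have "\<exists>c\<in>?I. \<forall>x\<in>?W. f x = spare_colouring q c x"
    \<comment> \<open>The colour class of \<open>m\<close> is independent, so it stays inside one
      part unless it contains \<open>(0, 0)\<close> and one of its non-neighbours in part 1.\<close>
    proof (cases "f (0, 0) = m \<and> (\<exists>j<d. f (1, j) = m)")
      case True
      then obtain j where j: "j < d" "f (1, j) = m" and u: "f (0, 0) = m" by blast
      have W_j: "(1, j) \<in> ?W" and W_u: "(0, 0) \<in> ?W" using assms j by (auto simp: W)
      \<comment> \<open>A vertex \<open>(1, s)\<close> is adjacent to \<open>(0, 0)\<close> and
        cannot have colour \<open>m\<close>, so subsets of \<open>{..<s}\<close> suffice and this
        case costs only \<open>2 ^ s\<close>.\<close>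
      define X where "X = {b. b < s \<and> f (1, b) = m}"
      have "f x = spare_colouring q (q, p, X) x" if x: "x \<in> ?W" for x
      proof -
        have "f x \<noteq> m" if "x \<noteq> (0, 0)" "fst x \<noteq> 1"
          using f_adj[OF x W_j] that j(2) by (auto simp: doubleton_eq_iff)
        moreover have "f x \<noteq> m" if "fst x = 1" "snd x \<ge> s"
        proof -
          have "\<not> (\<exists>j<d. {x, (0, 0)} = {(0, 0), (1, j)})"
            using that assms(3) by (cases x) (auto simp: doubleton_eq_iff)
          then show ?thesis using f_adj[OF x W_u] that(1) u by simp
        qed
        moreover have "f x = m" if "x = (0, 0)" using that u by simp
        moreover have "f (1, snd x) = f x" if "fst x = 1" using that by (cases x) simp
        ultimately show ?thesis
          using val[OF x] pq unfolding spare_colouring_def X_def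
          by (cases "fst x = 1"; cases "x = (0, 0)"; cases "snd x < s"; cases "f x = m") (auto simp: prod_eq_iff)
      qed
      moreover have "(q, p, X) \<in> ?I" using p by (auto simp: X_def)
      ultimately show ?thesis by blast
    next
      case False
      have same: "fst x = fst y" if "x \<in> ?W" "y \<in> ?W" "f x = m" "f y = m" for x y
        using f_adj[OF that(1,2)] that(3,4) False by (auto simp: doubleton_eq_iff)
      have "\<exists>i<q. \<forall>x\<in>?W. f x = m \<longrightarrow> fst x = i"
      proof (cases "\<exists>x\<in>?W. f x = m")
        case True
        then obtain y where y: "y \<in> ?W" "f y = m" by blast
        then have "fst y < q" by (auto simp: W)
        then show ?thesis using same[OF _ y(1) _ y(2)] by blast
      next
        case False
        then show ?thesis using assms(1) by (intro exI[of _ 0]) auto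
      qed
      then obtain i where iq: "i < q" and i: "\<And>x. x \<in> ?W \<Longrightarrow> f x = m \<Longrightarrow> fst x = i" by blast
      define X where "X = {b. (i, b) \<in> ?W \<and> f (i, b) \<noteq> m}"
      have "f x = spare_colouring q (i, p, X) x" if x: "x \<in> ?W" for x
      proof (cases "fst x = i")
        case True
        then have "snd x \<in> X \<longleftrightarrow> f x \<noteq> m" using x by (cases x) (simp add: X_def)
        then show ?thesis using val[OF x] pq iq True by (auto simp: spare_colouring_def)
      next
        case False
        then have "f x \<noteq> m" using i[OF x] by blast
        then show ?thesis using val[OF x] iq False by (simp add: spare_colouring_def)
      qed
      moreover have "(i, p, X) \<in> ?I" using p iq by (auto simp: X_def W)
      ultimately show ?thesis by blast
    qed
    then obtain c where "c \<in> ?I" "\<And>x. x \<in> ?W \<Longrightarrow> f x = spare_colouring q c x" by blast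
    then have "f = restrict (spare_colouring q c) ?W" using f_ext by (auto simp: fun_eq_iff)
    then show "f \<in> (\<lambda>c. restrict (spare_colouring q c) ?W) ` ?I" using \<open>c \<in> ?I\<close> by blast
  qed
  then have "card (proper_colourings (Suc q) ?H) \<le> card ?I" using finI by (rule surj_card_le[rotated])
  also have "card ?I = (\<Sum>i\<le>q. fact (Suc q) * 2 ^ ?p i)"
    by (subst card_SigmaI)
      (auto simp: finite_permutations card_cartesian_product card_permutations[OF _ finite_lessThan] card_Pow
        simp del: fact_Suc)
  also have "\<dots> = fact (Suc q) * (\<Sum>i\<le>q. 2 ^ ?p i)" by (rule sum_distrib_left[symmetric])
  \<comment> \<open>Each of the \<open>q + 1\<close> codes contributes \<open>2 ^ s\<close>, and
    each of the \<open>t\<close> larger parts contributes \<open>2 ^ s\<close> once more.\<close>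
  also have "(\<Sum>i\<le>q. 2 ^ ?p i) = (\<Sum>i\<le>q. 2 ^ s + (if i < t then 2 ^ s else 0 :: nat))"
    by (intro sum.cong) auto
  also have "\<dots> = 2 ^ s * Suc q + card {i. i \<le> q \<and> i < t} * 2 ^ s"
    by (simp add: sum.distrib sum.If_cases Int_def)
  also have "{i. i \<le> q \<and> i < t} = {..<t}" using assms(2) by auto
  finally show ?thesis by (simp add: algebra_simps)
qed

section \<open>Numerical estimates\<close>

text \<open>Three terms of the binomial expansion; the surplus in the induction step is a
  nonnegative cubic term.\<close>

lemma quadratic_binomial_bound:
  fixes x :: real
  assumes "x \<ge> 0"
  shows "(1 + x) ^ n \<ge> 1 + n * x + real n * (real n - 1) / 2 * x\<^sup>2"
proof (induction n)
  case (Suc n)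
  have "(1 + x) ^ Suc n \<ge> (1 + x) * (1 + n * x + real n * (real n - 1) / 2 * x\<^sup>2)"
    using Suc assms by (simp add: mult_left_mono)
  moreover have "(1 + x) * (1 + n * x + real n * (real n - 1) / 2 * x\<^sup>2) =
      1 + Suc n * x + real (Suc n) * (real (Suc n) - 1) / 2 * x\<^sup>2 + real n * (real n - 1) / 2 * x ^ 3"
    by (simp add: field_simps power2_eq_square power3_eq_cube)
  moreover have "real n * (real n - 1) / 2 * x ^ 3 \<ge> 0"
    using assms by (cases n) auto
  ultimately show ?case by linarith
qed simp

text \<open>The quadratic term adds (1 - 1/q)/2 to Bernoulli's 2, which is at least 1/4 with
  equality at \<open>q = 2\<close>.\<close>

lemma one_plus_inverse_power_ge:
  assumes "q \<ge> 2"
  shows "(1 + 1 / real q) ^ q \<ge> 9 / 4"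
proof -
  have "1 / real q \<le> 1 / 2" using assms by (intro divide_left_mono) auto
  then have "9 / 4 \<le> 2 + (1 - 1 / real q) / 2" by simp
  also have "\<dots> = 1 + q * (1 / real q) + real q * (real q - 1) / 2 * (1 / real q)\<^sup>2"
    using assms by (simp add: field_simps power2_eq_square)
  also have "\<dots> \<le> (1 + 1 / real q) ^ q" by (rule quadratic_binomial_bound) simp
  finally show ?thesis .
qed

text \<open>With \<open>c\<close> the rounded logarithm, r^2 \<le> 4^c, and twelve factors 9/8
  outweigh each factor 4. Strictness needs \<open>c > 0\<close>.\<close>

lemma nine_eighths_power_gt:
  assumes "r \<ge> 2" "int s \<ge> 12 * \<lceil>log 2 (real r)\<rceil>"
  shows "(9 / 8 :: real) ^ s > r\<^sup>2" "s \<ge> 12"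
proof -
  define c where "c = nat \<lceil>log 2 (real r)\<rceil>"
  have "log 2 (real r) > 0" using assms(1) by simp
  then have c: "int c = \<lceil>log 2 (real r)\<rceil>" "c > 0" by (simp_all add: c_def)
  have s: "s \<ge> 12 * c" using assms(2) c(1) by linarith
  then show "s \<ge> 12" using c(2) by simp
  have "log 2 (real r) \<le> c" using c(1) by linarith
  then have "real r \<le> 2 powr c" using assms(1) by (simp add: le_powr_iff)
  then have "real r \<le> 2 ^ c" by (simp add: powr_realpow)
  then have "(real r)\<^sup>2 \<le> (2 ^ c)\<^sup>2" by (intro power_mono) auto
  also have "\<dots> = 4 ^ c" by (simp add: power2_eq_square flip: power_mult_distrib)
  also have "\<dots> < ((9 / 8) ^ 12) ^ c" using c(2) by (intro power_strict_mono) (auto simp: power_divide)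
  also have "\<dots> = (9 / 8) ^ (12 * c)" by (simp only: power_mult)
  also have "\<dots> \<le> (9 / 8 :: real) ^ s" using s by (intro power_increasing) auto
  finally show "(9 / 8 :: real) ^ s > r\<^sup>2" by simp
qed

text \<open>This compares the leading coefficients after division by \<open>q!\<close>. The
  \<open>t\<close> vertices of the last tile pay for the summand \<open>t\<close>, since r + t \<le>
  r (1 + 1/q)^t by Bernoulli; the full tiles pay for \<open>2 ^ s\<close> with (9/4)^s, and the rest
  (9/8)^s exceeds r^2.\<close>

lemma colouring_gap:
  assumes "q \<ge> 2" "t < q" "(9 / 8 :: real) ^ s > (Suc q)\<^sup>2"
  shows "Suc q * (2 ^ s * (Suc q + t)) * q ^ (q * s + t) < Suc q ^ (q * s + t)"
proof -
  let ?r = "real (Suc q)" and ?h = "q * s + t"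
  have q: "real q > 0" using assms by simp
  have "?r * (?r + t) \<le> ?r\<^sup>2 * (1 + t / q)"
    using q by (simp add: field_simps power2_eq_square)
  also have "1 + t / q \<le> (1 + 1 / q) ^ t"
    using Bernoulli_inequality[of "1 / real q" t] q by (simp add: order_trans[of _ 0])
  finally have 1: "?r * (?r + t) \<le> ?r\<^sup>2 * (1 + 1 / q) ^ t" by (simp add: mult_left_mono)
  have "?r * (2 ^ s * (?r + t)) = 2 ^ s * (?r * (?r + t))" by simp
  also have "\<dots> \<le> 2 ^ s * (?r\<^sup>2 * (1 + 1 / q) ^ t)" using 1 by (intro mult_left_mono) auto
  also have "\<dots> < 2 ^ s * ((9 / 8) ^ s * (1 + 1 / q) ^ t)"
    using assms(3) by (intro mult_strict_left_mono mult_strict_right_mono) (auto simp: add_pos_nonneg)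
  also have "\<dots> = (9 / 4) ^ s * (1 + 1 / q) ^ t"
    by (simp flip: power_mult_distrib mult.assoc)
  also have "\<dots> \<le> ((1 + 1 / q) ^ q) ^ s * (1 + 1 / q) ^ t"
    using one_plus_inverse_power_ge[OF assms(1)] by (intro mult_right_mono power_mono) auto
  also have "\<dots> = (1 + 1 / q) ^ ?h" by (simp add: power_mult power_add)
  also have "1 + 1 / real q = ?r / q" using q by (simp add: field_simps)
  finally have "?r * (2 ^ s * (?r + t)) * real q ^ ?h < ?r ^ ?h"
    using q by (simp add: power_divide pos_less_divide_eq)
  then have "real (Suc q * (2 ^ s * (Suc q + t)) * q ^ ?h) < real (Suc q ^ ?h)"
    by (simp only: of_nat_mult of_nat_add of_nat_power of_nat_numeral)
  then show ?thesis by (simp only: of_nat_less_iff)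
qed

text \<open>For integers the gap is at least one, \<open>B + 1 \<le> r ^ h\<close>. It absorbs the
  shift by \<open>h\<close>, whose relative cost is at most \<open>h * x\<close> by Bernoulli's
  inequality.\<close>

lemma eventually_falling_power_gt:
  fixes r h B :: nat
  assumes "r > 0" "B < r ^ h"
  shows "\<forall>\<^sub>F N in sequentially. B * N ^ h < (r * N - h) ^ h"
proof (rule eventually_sequentiallyI)
  \<comment> \<open>The summand \<open>h\<close> gives \<open>x \<le> 1\<close> below, and
    \<open>h * h * r ^ h\<close> makes \<open>h * x * r ^ h\<close> less than 1.\<close>
  fix N assume N: "Suc (h + h * h * r ^ h) \<le> N"
  have N0: "real N > 0" and hN: "h \<le> r * N"
    using N assms(1) by (auto intro: le_trans[of h N])
  define x where "x = real h / (real r * real N)"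
  have x: "0 \<le> x" "x \<le> 1"
    using N0 hN assms(1) by (auto simp: x_def divide_le_eq simp flip: of_nat_mult)
  have "real h * x * real r ^ h < 1"
  proof -
    have "h * h * r ^ h < r * N" using N assms(1) by (auto intro: less_le_trans[of _ N])
    then have "real h * real h * real r ^ h < real r * real N"
      by (metis of_nat_less_iff of_nat_mult of_nat_power)
    then show ?thesis using N0 assms(1) by (simp add: x_def field_simps)
  qed
  moreover have "real B + 1 \<le> real r ^ h" using assms(2) by (metis Suc_leI of_nat_Suc of_nat_le_iff of_nat_power add.commute)
  ultimately have "real B < real r ^ h * (1 - h * x)" by (simp add: algebra_simps)
  also have "\<dots> \<le> real r ^ h * (1 - x) ^ h"
    using Bernoulli_inequality[of "- x" h] x by (intro mult_left_mono) auto
  finally have "real B * N ^ h < (real r * (1 - x) * N) ^ h"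
    using N0 by (simp add: power_mult_distrib)
  also have "real r * (1 - x) * N = real (r * N - h)"
    using N0 hN assms(1) by (simp add: x_def of_nat_diff field_simps)
  finally have "real (B * N ^ h) < real ((r * N - h) ^ h)" by simp
  then show "B * N ^ h < (r * N - h) ^ h" by (simp only: of_nat_less_iff)
qed

section \<open>The negative half and the conclusion\<close>

theorem not_turan_good_tiled_graph:
  assumes "q \<ge> 2" "t < q" "d < s" "s \<ge> 2" "(9 / 8 :: real) ^ s > (Suc q)\<^sup>2"
  shows "\<not> turan_good (Suc (Suc q)) (tiled_graph q s t d)"
proof
  let ?H = "tiled_graph q s t d" and ?h = "q * s + t"
  let ?B = "Suc q * (2 ^ s * (Suc q + t)) * q ^ ?h"
  assume "turan_good (Suc (Suc q)) ?H"
  then obtain n0 where n0: "\<And>n (G :: nat ugraph). n \<ge> n0 \<Longrightarrow> simple_graph G \<Longrightarrow> card (verts G) = n \<Longrightarrow>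
      \<not> contains_copy G (complete_graph (Suc (Suc q))) \<Longrightarrow>
      num_copies ?H G \<le> num_copies ?H (turan_graph (Suc q) n)"
    unfolding turan_good_def eventually_sequentially by auto
  have "\<forall>\<^sub>F N in sequentially. ?B * N ^ ?h < (Suc q * N - ?h) ^ ?h"
    using colouring_gap[OF assms(1,2,5)] by (intro eventually_falling_power_gt) auto
  then obtain N where N: "N \<ge> n0" "?B * N ^ ?h < (Suc q * N - ?h) ^ ?h"
    unfolding eventually_sequentially by (metis linorder_linear)
  \<comment> \<open>The order \<open>q * Suc q * N\<close> makes the parts equal in both graphs, of
    sizes \<open>Suc q * N\<close> and \<open>q * N\<close>.\<close>
  let ?R = "residue_graph q (Suc q * N)" and ?T = "turan_graph (Suc q) (Suc q * (q * N))"
  have h: "card (verts ?H) = ?h" using assms(2) by (simp add: card_verts_tiled_graph)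
  have fH: "finite (verts ?H)" using simple_tiled_graph by (simp add: simple_graph_def)
  have n: "q * (Suc q * N) = Suc q * (q * N)" by (simp only: ac_simps)
  have "n0 \<le> N * 1" using N(1) by simp
  also have "\<dots> \<le> N * (Suc q * q)" using assms(1) by (intro mult_le_mono2) simp
  finally have "n0 \<le> Suc q * (q * N)" by (simp only: ac_simps)
  moreover have "card (verts ?R) = Suc q * (q * N)" by (simp add: residue_graph_def n del: mult_Suc)
  moreover have "\<not> contains_copy ?R (complete_graph (Suc (Suc q)))"
    using assms(1) by (intro residue_graph_clique_free) auto
  ultimately have "num_copies ?H ?R \<le> num_copies ?H ?T"
    using n0 simple_residue_graph by blast
  moreover have sT: "simple_graph ?T" by (simp add: turan_graph_def simple_complete_multipartite)
  ultimately have le: "card (embs ?H ?R) \<le> card (embs ?H ?T)"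
    using num_copies_le_iff_embs[OF simple_tiled_graph simple_residue_graph sT] by blast
  have "card (embs ?H ?T) \<le> card (proper_colourings (Suc q) ?H) * (q * N) ^ ?h"
    using card_embs_turan_le[OF simple_tiled_graph, of "Suc q" q s t d "q * N"] h by simp
  also have "\<dots> \<le> fact (Suc q) * (2 ^ s * (Suc q + t)) * (q * N) ^ ?h"
    using card_proper_colourings_tiled_graph_le[OF assms(1-4)] by (rule mult_le_mono1)
  also have "\<dots> = fact q * (?B * N ^ ?h)" by (simp add: power_mult_distrib algebra_simps)
  also have "\<dots> < fact q * (Suc q * N - ?h) ^ ?h" using N(2) by simp
  also have "\<dots> \<le> card (embs ?H ?R)"
  proof -
    have "fst ` verts ?H = {..<q}"
      using assms(2,4) by (force simp: verts_tiled_graph image_iff)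
    moreover have "fst x \<noteq> fst y" if "adj ?H x y" for x y
      using that unfolding adj_tiled_graph by blast
    ultimately show ?thesis
      using card_embs_residue_ge[OF fH, of q fst "Suc q * N"] assms(1) h by simp
  qed
  finally show False using le by simp
qed

theorem theoremA1:
  fixes r s :: nat
  assumes "r \<ge> 3"
    and "int s \<ge> 12 * \<lceil>log 2 (real r)\<rceil>"
  shows "(\<forall>t. 1 \<le> t \<and> t \<le> r - 2 \<longrightarrow>
            turan_good r (G_graph r s t) \<and> \<not> turan_good (r + 1) (G_graph r s t)) \<and>
         (\<forall>d. 2 \<le> d \<and> d \<le> s - 1 \<longrightarrow>
            turan_good r (J_graph r s d) \<and> \<not> turan_good (r + 1) (J_graph r s d))"
proof -
  obtain q where q: "r = Suc q" "q \<ge> 2" using assms(1) by (cases r) auto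
  have s: "(9 / 8 :: real) ^ s > (Suc q)\<^sup>2" "s \<ge> 12"
    using nine_eighths_power_gt[of r s] assms q by auto
  have "turan_good r (tiled_graph q s t d) \<and> \<not> turan_good (r + 1) (tiled_graph q s t d)"
    if "t < q" "d < s" for t d
    using turan_good_tiled_graph[OF q(2) that] not_turan_good_tiled_graph[OF q(2) that _ s(1)] s(2) q(1)
    by simp
  then show ?thesis using q s(2) by (auto simp: G_graph_eq J_graph_eq)
qed

end
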